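(* Let $\tau>0$. The jump chain $\Lambda^\tau_0,\Lambda^\tau_1,\dots,\Lambda^\tau_{J(\tau)}$ of $(\lambda(t))_{t\ge\tau}$ is the Markov chain on $\mathcal P$ with initial distribution $\mathbb P[\Lambda_0^\tau=\lambda]=\mathrm e^{-\tau N(\lambda)}\prod_{j\ge1}(1-\mathrm e^{-j\tau})$, $\lambda\in\mathcal P$, absorbing state $\varnothing$ and the following update rule. Given $\Lambda^\tau_j=\lambda\ne\varnothing$, choose one of the $N(\lambda)$ boxes in the Young diagram $Y_\lambda$ uniformly at random and remove the row (of some random length $\kappa$) containing the chosen box and all rows of the same length $\kappa$ below it; if the new diagram is $Y_\mu$, then $\Lambda^\tau_{j+1}=\mu$. Hence, the transition probability from $\lambda\in\mathcal P_n$, $n\ge 1$, to $\mu$ is $p_{\lambda,\mu}=\kappa/n$ for all partitions $\mu$ which can be obtained from $\lambda$ by removing some (positive) number of parts equal to $\kappa$, and zero otherwise.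
   Context: $\mathcal P_n$ is the set of integer partitions of $n\ge0$, $\mathcal P=\bigcup_{n\ge0}\mathcal P_n$, $\varnothing$ is the empty partition of $0$. For $\lambda\in\mathcal P$, $N(\lambda)$ is the sum of its parts and $C_k(\lambda)$ is the number of parts equal to $k$. The Young diagram $Y_\lambda$ consists of unit boxes in the positive quadrant arranged in left-aligned rows of lengths $\lambda_1\ge\lambda_2\ge\dots$ placed one above another. Let $(\varepsilon_{k,j})_{k,j\ge1}$ be independent standard exponential random variables on a probability space. For $t>0$ let $\rho_k(t)=\inf\{r\ge0:\varepsilon_{k,r+1}\le kt\}$ and let $\lambda(t)$ be the random partition with $C_k(\lambda(t))=\rho_k(t)$ for all $k\ge1$. The process $(\lambda(t))_{t\ge\tau}$ is non-increasing and right-continuous, and it reaches its absorbing state $\varnothing$ after a finite random number $J(\tau)$ of jumps; $\Lambda^\tau_0=\lambda(\tau),\Lambda^\tau_1,\dots,\Lambda^\tau_{J(\tau)}=\varnothing$ are its successive distinct values (its jump chain). *)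

theory Defs
  imports "HOL-Probability.Probability" "HOL-Library.Multiset"
begin

text \<open>
  An integer partition is the multiset of its (positive) parts, so that \<open>N(\<lambda>)\<close> is
  \<^term>\<open>sum_mset\<close> and \<open>C\<^sub>k(\<lambda>)\<close> is \<^term>\<open>count\<close>.
\<close>

definition partitions_of :: "nat \<Rightarrow> nat multiset set" where
  "partitions_of n = {l. 0 \<notin># l \<and> sum_mset l = n}"

definition partitions :: "nat multiset set" where
  "partitions = (\<Union>n. partitions_of n)"


subsection \<open>The update rule\<close>

definition parts :: "nat multiset \<Rightarrow> nat list" where
  "parts l = rev (sorted_list_of_multiset l)"

text \<open>
  The pair \<open>(x, y)\<close> stands for the unit box with lower left corner \<open>(x, y)\<close> in the positive
  quadrant; row \<open>y = 0\<close> is the lowest one and has the largest length.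
\<close>

definition young_diagram :: "nat multiset \<Rightarrow> (nat \<times> nat) set" where
  "young_diagram l = {(x, y). y < length (parts l) \<and> x < parts l ! y}"

text \<open>
  The partition left after deleting the row containing the box \<open>(x, y)\<close> and all rows of the
  same length below it.
\<close>

definition remove_rows :: "nat multiset \<Rightarrow> nat \<times> nat \<Rightarrow> nat multiset" where
  "remove_rows l = (\<lambda>(x, y). mset (nths (parts l) (- {i. i \<le> y \<and> parts l ! i = parts l ! y})))"

definition update_rule :: "nat multiset \<Rightarrow> nat multiset pmf" where
  "update_rule l =
     (if l = {#} then return_pmf {#} else map_pmf (remove_rows l) (pmf_of_set (young_diagram l)))"


subsection \<open>The partition-valued process\<close>

definition rho :: "(nat \<Rightarrow> nat \<Rightarrow> 'a \<Rightarrow> real) \<Rightarrow> nat \<Rightarrow> real \<Rightarrow> 'a \<Rightarrow> enat" where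
  "rho \<epsilon> k t \<omega> = (INF r \<in> {r. \<epsilon> k (r + 1) \<omega> \<le> real k * t}. enat r)"

definition has_multiplicities ::
    "(nat \<Rightarrow> nat \<Rightarrow> 'a \<Rightarrow> real) \<Rightarrow> real \<Rightarrow> 'a \<Rightarrow> nat multiset \<Rightarrow> bool" where
  "has_multiplicities \<epsilon> t \<omega> l \<longleftrightarrow>
     l \<in> partitions \<and> (\<forall>k\<ge>1. enat (count l k) = rho \<epsilon> k t \<omega>)"

text \<open>
  Only almost surely do the \<^term>\<open>rho\<close> form the multiplicities of a partition for
  all \<open>t > 0\<close>. On the exceptional null set the path is set to be constantly empty.
\<close>

definition random_partition ::
    "(nat \<Rightarrow> nat \<Rightarrow> 'a \<Rightarrow> real) \<Rightarrow> real \<Rightarrow> 'a \<Rightarrow> nat multiset" where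
  "random_partition \<epsilon> t \<omega> =
     (if \<forall>s>0. \<exists>l. has_multiplicities \<epsilon> s \<omega> l then (THE l. has_multiplicities \<epsilon> t \<omega> l) else {#})"


subsection \<open>The jump chain of a right-continuous step path started at a given time\<close>

text \<open>
  If there is no further jump, \<open>jump_time\<close> stays at its last value, so beyond
  the last jump \<open>jump_chain\<close> repeats the final state of the path.
\<close>

fun jump_time :: "real \<Rightarrow> (real \<Rightarrow> 's) \<Rightarrow> nat \<Rightarrow> real" where
  "jump_time \<tau> X 0 = \<tau>"
| "jump_time \<tau> X (Suc j) =
     (let t = jump_time \<tau> X j in if \<exists>s>t. X s \<noteq> X t then Inf {s. s > t \<and> X s \<noteq> X t} else t)"

definition jump_chain :: "real \<Rightarrow> (real \<Rightarrow> 's) \<Rightarrow> nat \<Rightarrow> 's" where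
  "jump_chain \<tau> X j = X (jump_time \<tau> X j)"

definition num_jumps :: "real \<Rightarrow> (real \<Rightarrow> 's) \<Rightarrow> enat" where
  "num_jumps \<tau> X = (INF j \<in> {j. \<forall>s>jump_time \<tau> X j. X s = X (jump_time \<tau> X j)}. enat j)"


subsection \<open>Homogeneous Markov chains on a countable state space\<close>

definition markov_chain ::
    "'a measure \<Rightarrow> 's set \<Rightarrow> ('s \<Rightarrow> real) \<Rightarrow> ('s \<Rightarrow> 's \<Rightarrow> real) \<Rightarrow> (nat \<Rightarrow> 'a \<Rightarrow> 's) \<Rightarrow> bool" where
  "markov_chain M S init p X \<longleftrightarrow>
     (\<forall>j. X j \<in> measurable M (count_space S)) \<and>
     (\<forall>x\<in>S. \<P>(\<omega> in M. X 0 \<omega> = x) = init x) \<and>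
     (\<forall>j x. (\<forall>i\<le>Suc j. x i \<in> S) \<longrightarrow> \<P>(\<omega> in M. \<forall>i\<le>j. X i \<omega> = x i) > 0 \<longrightarrow>
        \<P>(\<omega> in M. X (Suc j) \<omega> = x (Suc j) \<bar> \<forall>i\<le>j. X i \<omega> = x i) = p (x j) (x (Suc j)))"

end

theory Submission
  imports Defs "HOL-Real_Asymp.Real_Asymp"
begin

text \<open>
  Attach to the \<open>j\<close>-th row of length \<open>k\<close> the clock \<open>\<epsilon> k j / k\<close>, exponential with rate \<open>k\<close>. The
  partition at time \<open>t\<close> is \<open>l\<close> if and only if the clocks of all rows of \<open>l\<close> ring after \<open>t\<close> and, for
  every length \<open>k\<close>, the clock of the first row missing from \<open>l\<close> has rung by \<open>t\<close>
  (\<open>has_multiplicities_iff\<close>). Hence the next jump happens when the first clock of a present row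
  rings. If this is the clock of \<open>(k, j)\<close>, exactly the rows \<open>(k, i)\<close> with \<open>i \<ge> j\<close> disappear. Among the
  present rows, \<open>(k, j)\<close> rings first with probability proportional to its rate \<open>k\<close>, its number of
  boxes, and the rates add up to the number of all boxes. This is the update rule
  (\<open>pmf_update_rule_strike\<close>).

  By the lack of memory, the clocks that are still running start afresh after every jump.
  Instead of conditioning on jump times, the lemma \<open>emeasure_race\<close> computes the joint
  probability of a whole sequence of first rings, by integrating out the first of them and
  induction on the number of rounds. Up to absorption, a sequence of states of the jump chain
  determines the row that rings first in every round, so the probability of the sequence is
  the initial probability times the product of the transition probabilities (\<open>prob_path\<close>),
  which is the Markov property. The initial law is the case of no rounds.

  Two null sets are discarded: by the Borel--Cantelli lemma almost surely every state is a
  finite partition (\<open>AE_regular\<close>), and almost surely no two clocks ring simultaneously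
  (\<open>AE_inj_on_clock\<close>). Finiteness of the number of jumps and absorption hold on every path.
\<close>

section \<open>Racing exponential clocks\<close>

text \<open>The exponential distribution of rate one.\<close>

abbreviation Exp1 :: "real measure" where
  "Exp1 \<equiv> density lborel (exponential_density 1)"

lemma prob_space_Exp1: "prob_space Exp1"
  by (rule prob_space_exponential_density) simp

lemma emeasure_Exp1_greaterThan:
  assumes "0 \<le> a"
  shows "emeasure Exp1 {a<..} = ennreal (exp (- a))"
proof -
  interpret prob_space Exp1 by (rule prob_space_Exp1)
  have "distributed Exp1 lborel (\<lambda>x. x) (exponential_density 1)"
    unfolding distributed_def by (auto simp: distr_id2)
  from exponential_distributedD_gt[OF this assms] have "prob {x. a < x} = exp (- a)"
    by simp
  then show ?thesis
    by (simp add: emeasure_eq_measure greaterThan_def)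
qed

lemma emeasure_Exp1_atMost:
  assumes "0 \<le> a"
  shows "emeasure Exp1 {..a} = ennreal (1 - exp (- a))"
proof -
  interpret prob_space Exp1 by (rule prob_space_Exp1)
  have "prob {..a} = 1 - prob {a<..}"
    using prob_compl[of "{a<..}"] by (simp add: Compl_eq_Diff_UNIV[symmetric])
  also have "prob {a<..} = exp (- a)"
    using emeasure_Exp1_greaterThan[OF assms] by (simp add: emeasure_eq_measure)
  finally show ?thesis by (simp add: emeasure_eq_measure)
qed

lemma nn_integral_Exp1_tail:
  assumes "0 \<le> a" "0 \<le> c"
  shows "(\<integral>\<^sup>+t. ennreal (exp (- c * t)) * indicator {a<..} t \<partial>Exp1) =
    ennreal (exp (- (c + 1) * a) / (c + 1))"
proof -
  have "(\<integral>\<^sup>+t. ennreal (exp (- c * t)) * indicator {a<..} t \<partial>Exp1) =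
      (\<integral>\<^sup>+t. ennreal (exponential_density 1 t) * (ennreal (exp (- c * t)) * indicator {a<..} t) \<partial>lborel)"
    by (subst nn_integral_density) auto
  also have "\<dots> = (\<integral>\<^sup>+t. ennreal (exp (- (c + 1) * t)) * indicator {a<..} t \<partial>lborel)"
  proof (rule nn_integral_cong)
    fix t :: real
    show "ennreal (exponential_density 1 t) * (ennreal (exp (- c * t)) * indicator {a<..} t) =
        ennreal (exp (- (c + 1) * t)) * indicator {a<..} t"
      using assms by (auto simp: exponential_density_def indicator_def ennreal_mult'[symmetric]
          exp_add[symmetric] algebra_simps)
  qed
  also have "\<dots> = (\<integral>\<^sup>+t. ennreal (exp (- (c + 1) * t)) * indicator {a..} t \<partial>lborel)"
    using AE_lborel_singleton[of a]
    by (intro nn_integral_cong_AE) (auto simp: indicator_def elim!: eventually_mono)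
  also have "\<dots> = ennreal (0 - - exp (- (c + 1) * a) / (c + 1))"
  proof (rule nn_integral_FTC_atLeast)
    have lim: "((\<lambda>t. - exp (- d * t) / d) \<longlongrightarrow> 0) at_top" if "0 < d" for d :: real
      using that by real_asymp
    show "((\<lambda>t. - exp (- (c + 1) * t) / (c + 1)) \<longlongrightarrow> 0) at_top"
      by (rule lim) (use assms in simp)
    show "((\<lambda>t. - exp (- (c + 1) * t) / (c + 1)) has_real_derivative exp (- (c + 1) * t)) (at t)" for t
      using assms by (auto intro!: derivative_eq_intros simp: divide_simps) argo
  qed auto
  finally show ?thesis by simp
qed

lemma sets_race:
  fixes a :: "'i \<Rightarrow> real" and R :: "nat \<Rightarrow> 'i set"
  assumes "finite I" "R 0 \<subseteq> I" "\<And>i. i < m \<Longrightarrow> r i \<in> R i \<and> R i \<subseteq> R 0"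
    and "\<And>q. q \<in> I - R 0 \<Longrightarrow> D q \<in> sets borel"
  shows "{x \<in> space (\<Pi>\<^sub>M q\<in>I. Exp1).
      (\<forall>q\<in>I - R 0. x q \<in> D q) \<and> (\<forall>q\<in>R 0. s * a q < x q) \<and>
      (\<forall>i<m. \<forall>q\<in>R i - {r i}. x (r i) / a (r i) < x q / a q)} \<in> sets (\<Pi>\<^sub>M q\<in>I. Exp1)"
proof (intro sets.sets_Collect_conj)
  have comp[measurable]: "(\<lambda>x. x q) \<in> borel_measurable (\<Pi>\<^sub>M q\<in>I. Exp1)" if "q \<in> I" for q
    using measurable_component_singleton[OF that, of "\<lambda>_. Exp1"] by simp
  have D: "{x \<in> space (\<Pi>\<^sub>M q\<in>I. Exp1). x q \<in> D q} \<in> sets (\<Pi>\<^sub>M q\<in>I. Exp1)" if "q \<in> I - R 0" for q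
    using measurable_sets[OF comp[of q] assms(4)[OF that]] that
    by (simp add: vimage_def Int_def conj_commute)
  have lt: "{x \<in> space (\<Pi>\<^sub>M q\<in>I. Exp1). x p / a p < x q / a q} \<in> sets (\<Pi>\<^sub>M q\<in>I. Exp1)"
      "{x \<in> space (\<Pi>\<^sub>M q\<in>I. Exp1). s * a q < x q} \<in> sets (\<Pi>\<^sub>M q\<in>I. Exp1)"
    if [measurable]: "p \<in> I" "q \<in> I" for p q
    by measurable
  have fin: "finite (R i)" "R i \<subseteq> I" "r i \<in> I" if "i < m" for i
    using assms(1,2) assms(3)[OF that] finite_subset[of "R i" I] by auto
  show "{x \<in> space (\<Pi>\<^sub>M q\<in>I. Exp1). \<forall>q\<in>I - R 0. x q \<in> D q} \<in> sets (\<Pi>\<^sub>M q\<in>I. Exp1)"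
    using D assms(1) by (intro sets.sets_Collect_finite_All) auto
  show "{x \<in> space (\<Pi>\<^sub>M q\<in>I. Exp1). \<forall>q\<in>R 0. s * a q < x q} \<in> sets (\<Pi>\<^sub>M q\<in>I. Exp1)"
    using lt(2) assms(1,2) finite_subset by (intro sets.sets_Collect_finite_All) auto
  have "{x \<in> space (\<Pi>\<^sub>M q\<in>I. Exp1). \<forall>i\<in>{..<m}. \<forall>q\<in>R i - {r i}.
      x (r i) / a (r i) < x q / a q} \<in> sets (\<Pi>\<^sub>M q\<in>I. Exp1)"
    using fin by (intro sets.sets_Collect_finite_All lt(1)) auto
  then show "{x \<in> space (\<Pi>\<^sub>M q\<in>I. Exp1). \<forall>i<m. \<forall>q\<in>R i - {r i}.
      x (r i) / a (r i) < x q / a q} \<in> sets (\<Pi>\<^sub>M q\<in>I. Exp1)"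
    by (simp only: Ball_def lessThan_iff)
qed

text \<open>
  For a finite family of independent rate-one exponential variables, \<open>x q / a q\<close> is a clock of
  rate \<open>a q\<close>. The event says that \<open>r i\<close> is the first clock to ring among those of \<open>R i\<close>, for a
  shrinking sequence of sets \<open>R i\<close>. The start \<open>s\<close> of the race and the side conditions \<open>D\<close> on
  the variables outside \<open>R 0\<close> make the induction on the number of rounds go through:
  integrating over the time at which \<open>r 0\<close> rings leaves a race on \<open>R 1\<close> started at that time,
  and the clocks of \<open>R 0\<close> discarded along with \<open>r 0\<close> are only required to ring later.
\<close>

lemma emeasure_race:
  fixes a :: "'i \<Rightarrow> real" and R :: "nat \<Rightarrow> 'i set"
  assumes "finite I" "R 0 \<subseteq> I" "0 \<le> s"
    and "\<And>q. q \<in> R 0 \<Longrightarrow> 0 < a q"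
    and "\<And>i. i < m \<Longrightarrow> r i \<in> R i \<and> R (Suc i) \<subseteq> R i - {r i}"
    and "\<And>q. q \<in> I - R 0 \<Longrightarrow> D q \<in> sets borel"
  shows "emeasure (\<Pi>\<^sub>M q\<in>I. Exp1) {x \<in> space (\<Pi>\<^sub>M q\<in>I. Exp1).
      (\<forall>q\<in>I - R 0. x q \<in> D q) \<and> (\<forall>q\<in>R 0. s * a q < x q) \<and>
      (\<forall>i<m. \<forall>q\<in>R i - {r i}. x (r i) / a (r i) < x q / a q)} =
    (\<Prod>q\<in>I - R 0. emeasure Exp1 (D q)) *
      ennreal (exp (- s * sum a (R 0)) * (\<Prod>i<m. a (r i) / sum a (R i)))"
  using assms
proof (induction m arbitrary: I R r s D)
  case 0
  interpret prob_space Exp1 by (rule prob_space_Exp1)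
  interpret product_sigma_finite "\<lambda>_. Exp1" by standard
  define E where "E q = (if q \<in> R 0 then {s * a q<..} else D q)" for q
  have "{x \<in> space (\<Pi>\<^sub>M q\<in>I. Exp1). (\<forall>q\<in>I - R 0. x q \<in> D q) \<and> (\<forall>q\<in>R 0. s * a q < x q) \<and>
      (\<forall>i<0. \<forall>q\<in>R i - {r i}. x (r i) / a (r i) < x q / a q)} = Pi\<^sub>E I E"
    using 0(2) by (auto simp: space_PiM PiE_iff extensional_def E_def split: if_splits)
  also have "emeasure (\<Pi>\<^sub>M q\<in>I. Exp1) (Pi\<^sub>E I E) = (\<Prod>q\<in>I. emeasure Exp1 (E q))"
    using 0 by (intro emeasure_PiM) (auto simp: E_def)
  also have "\<dots> = (\<Prod>q\<in>I - R 0. emeasure Exp1 (E q)) * (\<Prod>q\<in>R 0. emeasure Exp1 (E q))"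
    using 0 by (intro prod.subset_diff) auto
  also have "(\<Prod>q\<in>R 0. emeasure Exp1 (E q)) = (\<Prod>q\<in>R 0. ennreal (exp (- s * a q)))"
    using 0(3,4) by (intro prod.cong) (auto simp: E_def emeasure_Exp1_greaterThan less_imp_le)
  also have "\<dots> = ennreal (exp (- s * sum a (R 0)))"
    using 0(1,2) by (simp add: prod_ennreal exp_sum[symmetric] sum_distrib_left sum_negf finite_subset)
  finally show ?case by (simp add: E_def)
next
  case (Suc m)
  interpret prob_space Exp1 by (rule prob_space_Exp1)
  interpret product_sigma_finite "\<lambda>_. Exp1" by standard
  \<comment> \<open>\<open>q0\<close> is the first clock to ring; the integration over its variable comes last.\<close>
  define q0 J where "q0 = r 0" and "J = I - {q0}"
  define N where "N = sum a (R 0)"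
  have q0: "q0 \<in> R 0" and R1: "R 1 \<subseteq> R 0 - {q0}"
    using Suc.prems(5)[of 0] by (auto simp: q0_def)
  have I: "I = insert q0 J" "finite J" "q0 \<notin> J"
    using Suc.prems(1,2) q0 by (auto simp: J_def)
  have pos: "0 < a q" if "q \<in> R 0" for q using Suc.prems(4) that .
  have finR: "finite (R 0)" using Suc.prems(1,2) finite_subset by blast
  have dec: "R (Suc i) \<subseteq> R 1" if "i \<le> m" for i
    using that
  proof (induction i)
    case (Suc i)
    then show ?case using Suc.prems Suc.IH \<open>\<And>i. i < Suc m \<Longrightarrow> _ i\<close>[of "Suc i"] by auto
  qed simp
  have Ri: "R i \<subseteq> R 0" if "i \<le> Suc m" for i
    using that dec[of "i - 1"] R1 by (cases i) auto
  define A where "A = {x \<in> space (\<Pi>\<^sub>M q\<in>I. Exp1).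
      (\<forall>q\<in>I - R 0. x q \<in> D q) \<and> (\<forall>q\<in>R 0. s * a q < x q) \<and>
      (\<forall>i<Suc m. \<forall>q\<in>R i - {r i}. x (r i) / a (r i) < x q / a q)}"
  have A_meas: "A \<in> sets (\<Pi>\<^sub>M q\<in>I. Exp1)"
    unfolding A_def using Suc.prems(1,2,5,6) Ri by (intro sets_race) auto
  \<comment> \<open>What is left when \<open>q0\<close> rings at time \<open>t / a q0\<close>: a race on \<open>R 1\<close>, started at that time.\<close>
  define D' where "D' t q = (if q \<in> R 0 then {t / a q0 * a q<..} else D q)" for t q
  define B where "B t = {x \<in> space (\<Pi>\<^sub>M q\<in>J. Exp1).
      (\<forall>q\<in>J - R 1. x q \<in> D' t q) \<and> (\<forall>q\<in>R 1. t / a q0 * a q < x q) \<and>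
      (\<forall>i<m. \<forall>q\<in>R (Suc i) - {r (Suc i)}. x (r (Suc i)) / a (r (Suc i)) < x q / a q)}" for t
  have slice_iff: "x(q0 := t) \<in> A \<longleftrightarrow> s * a q0 < t \<and> x \<in> B t"
    if x: "x \<in> space (\<Pi>\<^sub>M q\<in>J. Exp1)" for x t
  proof -
    have "x(q0 := t) \<in> space (\<Pi>\<^sub>M q\<in>I. Exp1)"
      using x by (auto simp: I(1) space_PiM PiE_iff extensional_def)
    moreover have "(\<forall>q\<in>I - R 0. (x(q0 := t)) q \<in> D q) \<longleftrightarrow> (\<forall>q\<in>J - R 0. x q \<in> D q)"
      using q0 by (auto simp: J_def)
    moreover have "(\<forall>i<Suc m. \<forall>q\<in>R i - {r i}. (x(q0 := t)) (r i) / a (r i) < (x(q0 := t)) q / a q) \<longleftrightarrow>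
        (\<forall>q\<in>R 0 - {q0}. t / a q0 * a q < x q) \<and>
        (\<forall>i<m. \<forall>q\<in>R (Suc i) - {r (Suc i)}. x (r (Suc i)) / a (r (Suc i)) < x q / a q)"
    proof -
      have first: "(\<forall>q\<in>R 0 - {r 0}. (x(q0 := t)) (r 0) / a (r 0) < (x(q0 := t)) q / a q) \<longleftrightarrow>
          (\<forall>q\<in>R 0 - {q0}. t / a q0 * a q < x q)"
        unfolding q0_def[symmetric] using pos by (intro ball_cong) (auto simp: pos_less_divide_eq)
      have neq: "r (Suc i) \<noteq> q0" "q0 \<notin> R (Suc i)" if "i < m" for i
        using that dec[of i] R1 Suc.prems(5)[of "Suc i"] by auto
      have later: "(\<forall>q\<in>R (Suc i) - {r (Suc i)}.
            (x(q0 := t)) (r (Suc i)) / a (r (Suc i)) < (x(q0 := t)) q / a q) \<longleftrightarrow>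
          (\<forall>q\<in>R (Suc i) - {r (Suc i)}. x (r (Suc i)) / a (r (Suc i)) < x q / a q)"
        if "i < m" for i
        using neq[OF that] by (intro ball_cong) auto
      show ?thesis
        unfolding All_less_Suc2 first by (intro arg_cong2[of _ _ _ _ "(\<and>)"] refl all_cong later)
    qed
    moreover have "(\<forall>q\<in>R 0. s * a q < (x(q0 := t)) q) \<longleftrightarrow> s * a q0 < t"
      if rung: "\<forall>q\<in>R 0 - {q0}. t / a q0 * a q < x q"
    proof -
      have "s * a q < x q" if "s * a q0 < t" "q \<in> R 0 - {q0}" for q
      proof -
        have "s < t / a q0" using that(1) pos[OF q0] by (simp add: pos_less_divide_eq)
        then have "s * a q < t / a q0 * a q" using pos[of q] that(2) by (intro mult_strict_right_mono) auto
        also have "\<dots> < x q" using rung that(2) by blast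
        finally show ?thesis .
      qed
      then show ?thesis using q0 by auto
    qed
    moreover have "(\<forall>q\<in>J - R 0. x q \<in> D q) \<and> (\<forall>q\<in>R 0 - {q0}. t / a q0 * a q < x q) \<longleftrightarrow>
        (\<forall>q\<in>J - R 1. x q \<in> D' t q) \<and> (\<forall>q\<in>R 1. t / a q0 * a q < x q)"
      using R1 Suc.prems(2) by (auto simp: D'_def J_def)
    ultimately show ?thesis
      unfolding A_def B_def using x by blast
  qed
  then have slice: "indicator A (x(q0 := t)) =
      (indicator {s * a q0<..} t * indicator (B t) x :: ennreal)"
    if "x \<in> space (\<Pi>\<^sub>M q\<in>J. Exp1)" for x t
    using that by (auto simp: indicator_def)
  have B_space: "B t \<subseteq> space (\<Pi>\<^sub>M q\<in>J. Exp1)" for t by (auto simp: B_def)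
  define P where "P = (\<Prod>q\<in>I - R 0. emeasure Exp1 (D q))"
  define Q where "Q = (\<Prod>i<m. a (r (Suc i)) / sum a (R (Suc i)))"
  have a_nn: "0 \<le> a q" if "q \<in> R i" "i \<le> Suc m" for q i
    using that Ri[of i] pos[of q] by auto
  have Q: "0 \<le> Q" unfolding Q_def
  proof (intro prod_nonneg divide_nonneg_nonneg sum_nonneg)
    fix i assume "i \<in> {..<m}"
    then show "0 \<le> a (r (Suc i))" using Suc.prems(5)[of "Suc i"] a_nn[of _ "Suc i"] by simp
  qed (use a_nn in auto)
  have N: "N = a q0 + sum a (R 0 - {q0})"
    unfolding N_def using finR q0 by (rule sum.remove)
  have sum_nn: "0 \<le> sum a (R 0 - {q0})"
    using pos by (intro sum_nonneg) (auto simp: less_imp_le)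
  have B: "emeasure (\<Pi>\<^sub>M q\<in>J. Exp1) (B t) = P * ennreal Q * ennreal (exp (- ((N / a q0) - 1) * t))"
    and B_meas: "B t \<in> sets (\<Pi>\<^sub>M q\<in>J. Exp1)"
    if t: "s * a q0 < t" for t
  proof -
    have t0: "0 < t" using t Suc.prems(3) pos[OF q0] by (meson le_less_trans less_imp_le mult_nonneg_nonneg)
    have "emeasure (\<Pi>\<^sub>M q\<in>J. Exp1) (B t) = (\<Prod>q\<in>J - R 1. emeasure Exp1 (D' t q)) *
        ennreal (exp (- (t / a q0) * sum a (R 1)) * Q)"
      unfolding B_def Q_def
    proof (rule Suc.IH[of J "\<lambda>i. R (Suc i)" "t / a q0" "\<lambda>i. r (Suc i)" "D' t", folded One_nat_def])
      show "finite J" "R 1 \<subseteq> J" "0 \<le> t / a q0"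
        using I(2) R1 Suc.prems(2) t0 pos[OF q0] by (auto simp: J_def)
      show "0 < a q" if "q \<in> R 1" for q using that R1 pos by auto
      show "r (Suc i) \<in> R (Suc i) \<and> R (Suc (Suc i)) \<subseteq> R (Suc i) - {r (Suc i)}" if "i < m" for i
        using Suc.prems(5)[of "Suc i"] that by simp
      show "D' t q \<in> sets borel" if "q \<in> J - R 1" for q
        using Suc.prems(6)[of q] that by (auto simp: D'_def J_def)
    qed
    \<comment> \<open>The new side conditions are the old ones and those on the discarded clocks.\<close>
    also have "(\<Prod>q\<in>J - R 1. emeasure Exp1 (D' t q)) =
        (\<Prod>q\<in>J - R 1 - (R 0 - {q0} - R 1). emeasure Exp1 (D' t q)) *
        (\<Prod>q\<in>R 0 - {q0} - R 1. emeasure Exp1 (D' t q))"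
      using Suc.prems(2) I(2) by (intro prod.subset_diff) (auto simp: J_def)
    also have "(\<Prod>q\<in>J - R 1 - (R 0 - {q0} - R 1). emeasure Exp1 (D' t q)) = P"
      unfolding P_def using R1 q0 by (intro prod.cong) (auto simp: J_def D'_def)
    also have "(\<Prod>q\<in>R 0 - {q0} - R 1. emeasure Exp1 (D' t q)) =
        (\<Prod>q\<in>R 0 - {q0} - R 1. ennreal (exp (- (t / a q0) * a q)))"
      using pos t0 q0 by (intro prod.cong refl)
        (auto simp: D'_def emeasure_Exp1_greaterThan less_imp_le)
    also have "\<dots> = ennreal (exp (- (t / a q0) * sum a (R 0 - {q0} - R 1)))"
      using finR by (simp add: prod_ennreal exp_sum[symmetric] sum_distrib_left sum_negf)
    also have "P * ennreal (exp (- (t / a q0) * sum a (R 0 - {q0} - R 1))) *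
        ennreal (exp (- (t / a q0) * sum a (R 1)) * Q) =
        P * ennreal Q * ennreal (exp (- (t / a q0) * (sum a (R 0 - {q0} - R 1) + sum a (R 1))))"
      using Q by (simp only: distrib_left exp_add) (simp add: ennreal_mult mult_ac)
    also have "sum a (R 0 - {q0} - R 1) + sum a (R 1) = sum a (R 0 - {q0})"
      using finR R1 by (intro sum.subset_diff[symmetric]) auto
    also have "- (t / a q0) * sum a (R 0 - {q0}) = - ((N / a q0) - 1) * t"
      using pos[OF q0] by (simp add: N field_simps)
    finally show "emeasure (\<Pi>\<^sub>M q\<in>J. Exp1) (B t) =
        P * ennreal Q * ennreal (exp (- ((N / a q0) - 1) * t))" .
    have "(\<lambda>x. x(q0 := t)) \<in> measurable (\<Pi>\<^sub>M q\<in>J. Exp1) (\<Pi>\<^sub>M q\<in>I. Exp1)"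
      unfolding I(1) by (rule measurable_fun_upd[where J=J]) auto
    then have "(\<lambda>x. x(q0 := t)) -` A \<inter> space (\<Pi>\<^sub>M q\<in>J. Exp1) \<in> sets (\<Pi>\<^sub>M q\<in>J. Exp1)"
      using A_meas by (rule measurable_sets)
    also have "(\<lambda>x. x(q0 := t)) -` A \<inter> space (\<Pi>\<^sub>M q\<in>J. Exp1) = B t"
      using slice_iff t B_space by blast
    finally show "B t \<in> sets (\<Pi>\<^sub>M q\<in>J. Exp1)" .
  qed
  have "emeasure (\<Pi>\<^sub>M q\<in>I. Exp1) A = (\<integral>\<^sup>+x. indicator A x \<partial>(\<Pi>\<^sub>M q\<in>insert q0 J. Exp1))"
    using A_meas I(1) by simp
  also have "\<dots> = (\<integral>\<^sup>+t. (\<integral>\<^sup>+x. indicator A (x(q0 := t)) \<partial>(\<Pi>\<^sub>M q\<in>J. Exp1)) \<partial>Exp1)"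
    using I(2,3) A_meas unfolding I(1) by (intro product_nn_integral_insert_rev) auto
  also have "\<dots> = (\<integral>\<^sup>+t. P * ennreal Q *
      (ennreal (exp (- ((N / a q0) - 1) * t)) * indicator {s * a q0<..} t) \<partial>Exp1)"
  proof (rule nn_integral_cong)
    fix t :: real
    have "(\<integral>\<^sup>+x. indicator A (x(q0 := t)) \<partial>(\<Pi>\<^sub>M q\<in>J. Exp1)) =
        (\<integral>\<^sup>+x. indicator {s * a q0<..} t * indicator (B t) x \<partial>(\<Pi>\<^sub>M q\<in>J. Exp1))"
      by (intro nn_integral_cong slice)
    also have "\<dots> = P * ennreal Q *
      (ennreal (exp (- ((N / a q0) - 1) * t)) * indicator {s * a q0<..} t)"
      using B[of t] B_meas[of t] by (cases "s * a q0 < t") auto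
    finally show "(\<integral>\<^sup>+x. indicator A (x(q0 := t)) \<partial>(\<Pi>\<^sub>M q\<in>J. Exp1)) = P * ennreal Q *
      (ennreal (exp (- ((N / a q0) - 1) * t)) * indicator {s * a q0<..} t)" .
  qed
  also have "\<dots> = P * ennreal Q * ennreal (exp (- (N / a q0 - 1 + 1) * (s * a q0)) / (N / a q0 - 1 + 1))"
    using Suc.prems(3) pos[OF q0] N sum_nn
    by (subst nn_integral_cmult, simp, subst nn_integral_Exp1_tail) (auto simp: field_simps)
  also have "exp (- (N / a q0 - 1 + 1) * (s * a q0)) / (N / a q0 - 1 + 1) = exp (- s * N) * (a q0 / N)"
    using pos[OF q0] by (simp add: field_simps)
  also have "P * ennreal Q * ennreal (exp (- s * N) * (a q0 / N)) =
      P * ennreal (exp (- s * N) * (\<Prod>i<Suc m. a (r i) / sum a (R i)))"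
    using Q pos[OF q0] N sum_nn
    unfolding prod.lessThan_Suc_shift Q_def[symmetric] N_def[symmetric] q0_def[symmetric]
    by (simp add: ennreal_mult[symmetric] mult_ac)
  finally show ?case unfolding A_def P_def N_def .
qed

section \<open>The path of the partition process\<close>

text \<open>
  The pair \<open>(k, j)\<close> stands for the \<open>j\<close>-th row of length \<open>k\<close>, counted from \<open>1\<close> and from the top of
  the diagram, so that the rows deleted along with \<open>(k, j)\<close> by the update rule are those with
  larger \<open>j\<close>.
\<close>

definition young_rows :: "nat multiset \<Rightarrow> (nat \<times> nat) set" where
  "young_rows l = {(k, j). 1 \<le> j \<and> j \<le> count l k}"

text \<open>What is left of \<open>l\<close> when, for a row \<open>(k, j)\<close> of \<open>l\<close>, all rows \<open>(k, i)\<close> with \<open>i \<ge> j\<close> are deleted.\<close>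

definition strike :: "nat multiset \<Rightarrow> nat \<times> nat \<Rightarrow> nat multiset" where
  "strike l = (\<lambda>(k, j). l - replicate_mset (Suc (count l k) - j) k)"

text \<open>
  The time \<open>t\<close> from which on the variable attached to a row of length \<open>k \<ge> 1\<close> is at most its
  threshold \<open>k t\<close>. Division by zero makes the value irrelevant but harmless for \<open>k = 0\<close>, which
  is not the length of a row of a partition.
\<close>

definition clock :: "(nat \<Rightarrow> nat \<Rightarrow> 'a \<Rightarrow> real) \<Rightarrow> 'a \<Rightarrow> nat \<times> nat \<Rightarrow> real" where
  "clock \<epsilon> \<omega> q = \<epsilon> (fst q) (snd q) \<omega> / real (fst q)"

text \<open>
  Every state of the path is a partition, that is, at all positive times the \<open>\<rho>\<^sub>k\<close> are finite
  and almost all of them vanish.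
\<close>

definition regular :: "(nat \<Rightarrow> nat \<Rightarrow> 'a \<Rightarrow> real) \<Rightarrow> 'a \<Rightarrow> bool" where
  "regular \<epsilon> \<omega> \<longleftrightarrow> (\<forall>s>0. \<exists>l. has_multiplicities \<epsilon> s \<omega> l)"

subsection \<open>Rows of a partition\<close>

lemma partitions_iff: "l \<in> partitions \<longleftrightarrow> 0 \<notin># l"
  by (auto simp: partitions_def partitions_of_def)

lemma rows_eq_Sigma: "young_rows l = (SIGMA k:set_mset l. {1..count l k})"
  by (auto simp: young_rows_def count_greater_zero_iff[symmetric] simp del: count_greater_zero_iff)

lemma finite_rows: "finite (young_rows l)"
  by (simp add: rows_eq_Sigma)

lemma rows_eq_empty_iff: "young_rows l = {} \<longleftrightarrow> l = {#}"
  by (auto simp: rows_eq_Sigma Sigma_empty_iff)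

lemma rows_subset: "l \<in> partitions \<Longrightarrow> young_rows l \<subseteq> {1..} \<times> {1..}"
  by (auto simp: rows_eq_Sigma partitions_iff ) (metis Suc_leI gr0I)

lemma sum_count_mult:
  "finite S \<Longrightarrow> set_mset l \<subseteq> S \<Longrightarrow> (\<Sum>k\<in>S. count l k * k) = sum_mset l" for l :: "nat multiset"
proof (induction l)
  case (add x l)
  have "(\<Sum>k\<in>S. count (add_mset x l) k * k) = (\<Sum>k\<in>S. count l k * k + (if k = x then x else 0))"
    by (intro sum.cong) auto
  with add show ?case by (simp add: sum.distrib)
qed simp

lemma sum_rows: "(\<Sum>q\<in>young_rows l. real (fst q)) = real (sum_mset l)"
proof -
  have "(\<Sum>q\<in>young_rows l. real (fst q)) = (\<Sum>k\<in>set_mset l. real (count l k) * real k)"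
    using sum.Sigma[of "set_mset l" "\<lambda>k. {1..count l k}" "\<lambda>k _. real k"]
    by (simp add: rows_eq_Sigma case_prod_beta)
  also have "\<dots> = real (sum_mset l)"
    by (simp add: sum_count_mult[OF finite_set_mset order_refl, symmetric])
  finally show ?thesis .
qed

lemma count_strike:
  "(k, j) \<in> young_rows l \<Longrightarrow> count (strike l (k, j)) i = (if i = k then j - 1 else count l i)"
  by (auto simp: strike_def young_rows_def)

lemma rows_strike: "(k, j) \<in> young_rows l \<Longrightarrow> young_rows (strike l (k, j)) = young_rows l - {(k, i) |i. j \<le> i}"
  by (auto simp: young_rows_def[of "strike _ _"] count_strike)
    (auto simp: young_rows_def split: if_splits)

lemma rows_strike_subset: "q \<in> young_rows l \<Longrightarrow> young_rows (strike l q) \<subseteq> young_rows l - {q}"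
  by (cases q) (auto simp: rows_strike)

lemma strike_partition: "l \<in> partitions \<Longrightarrow> strike l q \<in> partitions"
  by (auto simp: strike_def partitions_iff split: prod.splits dest: in_diffD)

lemma strike_inject:
  assumes "q \<in> young_rows l" "q' \<in> young_rows l" "strike l q = strike l q'"
  shows "q = q'"
proof -
  obtain k j k' j' where q: "q = (k, j)" "q' = (k', j')" by fastforce
  have *: "(if i = k then j - 1 else count l i) = (if i = k' then j' - 1 else count l i)" for i
    using assms by (simp add: q count_strike[symmetric])
  have "1 \<le> j" "j \<le> count l k" "1 \<le> j'" "j' \<le> count l k'"
    using assms by (auto simp: q young_rows_def)
  with *[of k] *[of k'] show ?thesis by (auto simp: q split: if_splits)
qed

lemma strike_iff:
  "(\<exists>q\<in>young_rows l. m = strike l q) \<longleftrightarrow> (\<exists>\<kappa> r. 1 \<le> r \<and> r \<le> count l \<kappa> \<and> m = l - replicate_mset r \<kappa>)"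
proof safe
  fix k j assume "(k, j) \<in> young_rows l"
  then show "\<exists>\<kappa> r. 1 \<le> r \<and> r \<le> count l \<kappa> \<and> strike l (k, j) = l - replicate_mset r \<kappa>"
    by (intro exI[of _ k] exI[of _ "Suc (count l k) - j"]) (auto simp: young_rows_def strike_def)
next
  fix k r assume "1 \<le> r" "r \<le> count l k"
  then show "\<exists>q\<in>young_rows l. l - replicate_mset r k = strike l q"
    by (intro bexI[of _ "(k, Suc (count l k) - r)"]) (auto simp: young_rows_def strike_def)
qed

subsection \<open>Reading the state off the clocks\<close>

lemma all_ge_1_iff: "(\<forall>k\<ge>1. P k) \<longleftrightarrow> (\<forall>k. P (Suc k))"
  by (metis Suc_le_D Suc_le_mono One_nat_def le0)

lemma enat_eq_INF_iff:
  "enat c = (INF r \<in> A. enat r) \<longleftrightarrow> c \<in> A \<and> (\<forall>r<c. r \<notin> A)"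
proof
  assume eq: "enat c = (INF r \<in> A. enat r)"
  then have "A \<noteq> {}" by (auto simp: top_enat_def)
  then have "Inf (enat ` A) \<in> enat ` A" by (metis image_is_empty wellorder_InfI ex_in_conv)
  then have "c \<in> A" using eq by auto
  moreover have "c \<le> r" if "r \<in> A" for r
  proof -
    have "enat c \<le> enat r" unfolding eq using that by (rule INF_lower)
    then show ?thesis by simp
  qed
  ultimately show "c \<in> A \<and> (\<forall>r<c. r \<notin> A)" by (meson not_le)
next
  assume "c \<in> A \<and> (\<forall>r<c. r \<notin> A)"
  then show "enat c = (INF r \<in> A. enat r)"
    by (intro antisym INF_greatest INF_lower) (auto simp: not_less[symmetric])
qed

lemma has_multiplicities_iff:
  "has_multiplicities \<epsilon> t \<omega> l \<longleftrightarrow> l \<in> partitions \<and>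
    (\<forall>q\<in>young_rows l. t < clock \<epsilon> \<omega> q) \<and> (\<forall>k\<ge>1. clock \<epsilon> \<omega> (k, Suc (count l k)) \<le> t)"
proof (cases "l \<in> partitions")
  case True
  have "enat (count l k) = rho \<epsilon> k t \<omega> \<longleftrightarrow>
      (\<forall>j. (k, j) \<in> young_rows l \<longrightarrow> t < clock \<epsilon> \<omega> (k, j)) \<and> clock \<epsilon> \<omega> (k, Suc (count l k)) \<le> t"
    if k: "1 \<le> k" for k
  proof -
    have "(\<forall>r<count l k. \<not> \<epsilon> k (Suc r) \<omega> \<le> real k * t) \<longleftrightarrow>
        (\<forall>j. (k, j) \<in> young_rows l \<longrightarrow> t < clock \<epsilon> \<omega> (k, j))"
    proof -
      have "(\<forall>j. (k, j) \<in> young_rows l \<longrightarrow> t < clock \<epsilon> \<omega> (k, j)) \<longleftrightarrow>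
          (\<forall>j\<in>Suc ` {..<count l k}. real k * t < \<epsilon> k j \<omega>)"
        using k by (auto simp: young_rows_def clock_def pos_less_divide_eq mult.commute
            image_Suc_lessThan)
      then show ?thesis by (auto simp: not_le)
    qed
    then show ?thesis
      using k unfolding rho_def enat_eq_INF_iff
      by (auto simp: clock_def pos_divide_le_eq mult.commute)
  qed
  then have "(\<forall>k\<ge>1. enat (count l k) = rho \<epsilon> k t \<omega>) \<longleftrightarrow>
      (\<forall>k\<ge>1. \<forall>j. (k, j) \<in> young_rows l \<longrightarrow> t < clock \<epsilon> \<omega> (k, j)) \<and>
      (\<forall>k\<ge>1. clock \<epsilon> \<omega> (k, Suc (count l k)) \<le> t)"
    by auto
  also have "(\<forall>k\<ge>1. \<forall>j. (k, j) \<in> young_rows l \<longrightarrow> t < clock \<epsilon> \<omega> (k, j)) \<longleftrightarrow>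
      (\<forall>q\<in>young_rows l. t < clock \<epsilon> \<omega> q)"
    using rows_subset[OF True] by auto
  finally show ?thesis
    unfolding has_multiplicities_def using True by simp
qed (simp add: has_multiplicities_def)

lemma ex_has_multiplicities_iff:
  "(\<exists>l. has_multiplicities \<epsilon> s \<omega> l) \<longleftrightarrow> (\<forall>k. \<exists>j. clock \<epsilon> \<omega> (Suc k, Suc j) \<le> s) \<and>
    (\<forall>\<^sub>F k in sequentially. clock \<epsilon> \<omega> (Suc k, Suc 0) \<le> s)"
proof (intro iffI conjI)
  assume "\<exists>l. has_multiplicities \<epsilon> s \<omega> l"
  then obtain l where "has_multiplicities \<epsilon> s \<omega> l" ..
  then have l: "clock \<epsilon> \<omega> (Suc k, Suc (count l (Suc k))) \<le> s" for k
    by (simp add: has_multiplicities_iff)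
  then show "\<forall>k. \<exists>j. clock \<epsilon> \<omega> (Suc k, Suc j) \<le> s" by blast
  obtain K where K: "set_mset l \<subseteq> {..<K}"
    using finite_nat_iff_bounded[of "set_mset l"] by auto
  have "clock \<epsilon> \<omega> (Suc k, Suc 0) \<le> s" if "K \<le> k" for k
  proof -
    have "Suc k \<notin># l" using K that by auto
    with l[of k] show ?thesis by (simp add: not_in_iff)
  qed
  then show "\<forall>\<^sub>F k in sequentially. clock \<epsilon> \<omega> (Suc k, Suc 0) \<le> s"
    by (auto simp: eventually_sequentially)
next
  assume *: "(\<forall>k. \<exists>j. clock \<epsilon> \<omega> (Suc k, Suc j) \<le> s) \<and>
    (\<forall>\<^sub>F k in sequentially. clock \<epsilon> \<omega> (Suc k, Suc 0) \<le> s)"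
  define c where "c k = (if k = 0 then 0 else LEAST j. clock \<epsilon> \<omega> (k, Suc j) \<le> s)" for k
  obtain K where K: "\<And>k. K \<le> k \<Longrightarrow> clock \<epsilon> \<omega> (Suc k, Suc 0) \<le> s"
    using * by (auto simp: eventually_sequentially)
  have c_0: "c k = 0" if "K < k" for k
    using K[of "k - 1"] that by (auto simp: c_def intro: Least_equality)
  have "k \<le> K" if "0 < c k" for k
    using that c_0[of k] by (cases "K < k") auto
  then have "{k. 0 < c k} \<subseteq> {..K}" by auto
  then have "finite {k. 0 < c k}" by (rule finite_subset) simp
  then have count: "count (Abs_multiset c) = c" by simp
  have "has_multiplicities \<epsilon> s \<omega> (Abs_multiset c)"
    unfolding has_multiplicities_iff
  proof (intro conjI ballI allI impI)
    show "Abs_multiset c \<in> partitions"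
      using count by (simp add: partitions_iff not_in_iff c_def)
    show "clock \<epsilon> \<omega> (k, Suc (count (Abs_multiset c) k)) \<le> s" if "1 \<le> k" for k
    proof -
      have "\<exists>j. clock \<epsilon> \<omega> (k, Suc j) \<le> s" using * that by (cases k) auto
      then show ?thesis using that by (auto simp: count c_def intro: LeastI_ex)
    qed
    show "s < clock \<epsilon> \<omega> q" if "q \<in> young_rows (Abs_multiset c)" for q
    proof -
      obtain k j where kj: "q = (k, j)" by fastforce
      with that have q: "q = (k, j)" "1 \<le> j" "j \<le> c k"
        by (auto simp: young_rows_def count)
      then have "0 < k" by (cases k) (auto simp: c_def)
      with q have "j - 1 < (LEAST j. clock \<epsilon> \<omega> (k, Suc j) \<le> s)" by (simp add: c_def)
      from not_less_Least[OF this] q show ?thesis by simp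
    qed
  qed
  then show "\<exists>l. has_multiplicities \<epsilon> s \<omega> l" ..
qed

text \<open>The condition on all times is monotone, hence it suffices to check it along a null sequence.\<close>

lemma regular_iff:
  "regular \<epsilon> \<omega> \<longleftrightarrow> (\<forall>n. (\<forall>k. \<exists>j. clock \<epsilon> \<omega> (Suc k, Suc j) \<le> inverse (real (Suc n))) \<and>
    (\<forall>\<^sub>F k in sequentially. clock \<epsilon> \<omega> (Suc k, Suc 0) \<le> inverse (real (Suc n))))"
proof -
  define P where "P s \<longleftrightarrow> (\<forall>k. \<exists>j. clock \<epsilon> \<omega> (Suc k, Suc j) \<le> s) \<and>
    (\<forall>\<^sub>F k in sequentially. clock \<epsilon> \<omega> (Suc k, Suc 0) \<le> s)" for s
  have mono: "P t" if "P s" "s \<le> t" for s t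
  proof -
    have "\<exists>j. clock \<epsilon> \<omega> (Suc k, Suc j) \<le> t" for k
      using that unfolding P_def by (meson order_trans)
    moreover have "\<forall>\<^sub>F k in sequentially. clock \<epsilon> \<omega> (Suc k, Suc 0) \<le> t"
      using conjunct2[OF that(1)[unfolded P_def]] by (rule eventually_mono) (use that(2) in simp)
    ultimately show ?thesis by (simp add: P_def)
  qed
  have "(\<forall>s>0. P s) \<longleftrightarrow> (\<forall>n. P (inverse (real (Suc n))))"
  proof (intro iffI allI impI)
    fix s :: real assume P: "\<forall>n. P (inverse (real (Suc n)))" and "0 < s"
    then obtain n where "inverse (real (Suc n)) < s" using reals_Archimedean by blast
    then show "P s" using mono[OF P[rule_format, of n], of s] by simp
  qed auto
  then show ?thesis unfolding regular_def ex_has_multiplicities_iff P_def .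
qed

lemma has_multiplicities_antimono:
  assumes "has_multiplicities \<epsilon> t \<omega> l" "has_multiplicities \<epsilon> s \<omega> m" "t \<le> s"
  shows "m \<subseteq># l"
proof (rule mset_subset_eqI)
  fix k
  show "count m k \<le> count l k"
  proof (rule ccontr)
    assume *: "\<not> count m k \<le> count l k"
    then have "(k, Suc (count l k)) \<in> young_rows m" by (auto simp: young_rows_def)
    with assms have "1 \<le> k" "s < clock \<epsilon> \<omega> (k, Suc (count l k))"
      using rows_subset[of m] by (auto simp: has_multiplicities_iff)
    with assms show False by (force simp: has_multiplicities_iff)
  qed
qed

lemma random_partition_eq_iff:
  assumes "regular \<epsilon> \<omega>" "0 < t"
  shows "random_partition \<epsilon> t \<omega> = l \<longleftrightarrow> has_multiplicities \<epsilon> t \<omega> l"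
proof -
  from assms obtain m where m: "has_multiplicities \<epsilon> t \<omega> m" by (auto simp: regular_def)
  have uniq: "l = m" if "has_multiplicities \<epsilon> t \<omega> l" for l
    using has_multiplicities_antimono[OF m that] has_multiplicities_antimono[OF that m]
    by (simp add: subset_mset.eq_iff)
  have "random_partition \<epsilon> t \<omega> = m"
    using assms(1) the_equality[of "has_multiplicities \<epsilon> t \<omega>", OF m uniq]
    unfolding regular_def random_partition_def by simp
  with m uniq show ?thesis by blast
qed

lemma random_partition_not_regular: "\<not> regular \<epsilon> \<omega> \<Longrightarrow> random_partition \<epsilon> t \<omega> = {#}"
  by (auto simp: regular_def random_partition_def)

lemma random_partition_in_partitions:
  assumes "0 < t" shows "random_partition \<epsilon> t \<omega> \<in> partitions"
proof (cases "regular \<epsilon> \<omega>")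
  case True
  from random_partition_eq_iff[OF True assms] show ?thesis by (auto simp: has_multiplicities_def)
qed (simp add: random_partition_not_regular partitions_iff)

lemma random_partition_antimono:
  assumes "regular \<epsilon> \<omega>" "0 < t" "t \<le> s"
  shows "random_partition \<epsilon> s \<omega> \<subseteq># random_partition \<epsilon> t \<omega>"
  using assms random_partition_eq_iff[OF assms(1)] has_multiplicities_antimono
  by (metis less_le_trans)

subsection \<open>Jumps\<close>

text \<open>The next jump after \<open>t\<close> happens when the first clock of a row present at time \<open>t\<close> rings.\<close>

lemma next_jump:
  assumes reg: "regular \<epsilon> \<omega>" and t: "0 < t"
    and l: "random_partition \<epsilon> t \<omega> = l" "l \<noteq> {#}"
  defines "T \<equiv> Min (clock \<epsilon> \<omega> ` young_rows l)"
  shows "t < T" and "Inf {s. t < s \<and> random_partition \<epsilon> s \<omega> \<noteq> l} = T"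
    and "random_partition \<epsilon> T \<omega> \<subset># l" and "\<exists>s>t. random_partition \<epsilon> s \<omega> \<noteq> l"
proof -
  have hl: "has_multiplicities \<epsilon> t \<omega> l"
    using random_partition_eq_iff[OF reg t, of l] l by simp
  have ne: "clock \<epsilon> \<omega> ` young_rows l \<noteq> {}" and fin: "finite (clock \<epsilon> \<omega> ` young_rows l)"
    using l(2) by (auto simp: rows_eq_empty_iff finite_rows)
  show tT: "t < T"
    using hl ne fin by (simp add: T_def has_multiplicities_iff)
  have const: "random_partition \<epsilon> s \<omega> = l" if s: "t \<le> s" "s < T" for s
  proof -
    have "s < clock \<epsilon> \<omega> q" if "q \<in> young_rows l" for q
      using s fin that unfolding T_def by (auto intro: less_le_trans)
    with hl s have "has_multiplicities \<epsilon> s \<omega> l"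
      by (force simp: has_multiplicities_iff)
    with random_partition_eq_iff[OF reg] s t show ?thesis by auto
  qed
  obtain q where q: "q \<in> young_rows l" "clock \<epsilon> \<omega> q = T"
    using Min_in[OF fin ne] by (auto simp: T_def)
  have "q \<notin> young_rows (random_partition \<epsilon> T \<omega>)"
    using random_partition_eq_iff[OF reg, of T "random_partition \<epsilon> T \<omega>"] t tT q
    by (auto simp: has_multiplicities_iff)
  with q have neq: "random_partition \<epsilon> T \<omega> \<noteq> l" by auto
  with random_partition_antimono[OF reg t, of T] tT l show "random_partition \<epsilon> T \<omega> \<subset># l"
    by (auto simp: subset_mset_def)
  show "\<exists>s>t. random_partition \<epsilon> s \<omega> \<noteq> l" using tT neq by auto
  show "Inf {s. t < s \<and> random_partition \<epsilon> s \<omega> \<noteq> l} = T"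
    by (intro cInf_eq_minimum) (use tT neq const in \<open>auto simp: not_less[symmetric]\<close>)
qed

text \<open>If the first clock to ring is unique, exactly the rows struck by it disappear.\<close>

lemma random_partition_first_ring:
  assumes reg: "regular \<epsilon> \<omega>" and t: "0 < t"
    and l: "random_partition \<epsilon> t \<omega> = l"
    and q: "q \<in> young_rows l" "\<And>p. p \<in> young_rows l - {q} \<Longrightarrow> clock \<epsilon> \<omega> q < clock \<epsilon> \<omega> p"
  shows "random_partition \<epsilon> (clock \<epsilon> \<omega> q) \<omega> = strike l q"
proof -
  obtain k j where kj: "q = (k, j)" by fastforce
  have hl: "has_multiplicities \<epsilon> t \<omega> l"
    using random_partition_eq_iff[OF reg t, of l] l by simp
  then have tq: "t < clock \<epsilon> \<omega> q"
    using q(1) by (auto simp: has_multiplicities_iff)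
  have "has_multiplicities \<epsilon> (clock \<epsilon> \<omega> q) \<omega> (strike l q)"
    unfolding has_multiplicities_iff
  proof (intro conjI ballI allI impI)
    show "strike l q \<in> partitions"
      using hl by (auto simp: has_multiplicities_iff strike_partition)
    show "clock \<epsilon> \<omega> q < clock \<epsilon> \<omega> p" if "p \<in> young_rows (strike l q)" for p
      using rows_strike_subset[OF q(1)] that q(2) by blast
    show "clock \<epsilon> \<omega> (i, Suc (count (strike l q) i)) \<le> clock \<epsilon> \<omega> q" if "1 \<le> i" for i
    proof (cases "i = k")
      case True
      with q(1) have "Suc (count (strike l q) i) = j"
        by (simp add: kj count_strike) (simp add: young_rows_def)
      with True show ?thesis by (simp add: kj)
    next
      case False
      with q(1) have "count (strike l q) i = count l i" by (simp add: kj count_strike)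
      with hl that tq show ?thesis by (force simp: has_multiplicities_iff)
    qed
  qed
  with random_partition_eq_iff[OF reg] t tq show ?thesis by simp
qed

lemma first_clock:
  assumes inj: "inj_on (clock \<epsilon> \<omega>) ({1..} \<times> {1..})" and l: "l \<in> partitions" "l \<noteq> {#}"
  shows "\<exists>p\<in>young_rows l. clock \<epsilon> \<omega> p = Min (clock \<epsilon> \<omega> ` young_rows l) \<and>
    (\<forall>p'\<in>young_rows l - {p}. clock \<epsilon> \<omega> p < clock \<epsilon> \<omega> p')"
proof -
  let ?C = "clock \<epsilon> \<omega> ` young_rows l"
  have "Min ?C \<in> ?C"
    using l(2) by (intro Min_in) (auto simp: finite_rows rows_eq_empty_iff)
  then obtain p where p: "p \<in> young_rows l" "clock \<epsilon> \<omega> p = Min ?C" by force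
  have "clock \<epsilon> \<omega> p < clock \<epsilon> \<omega> p'" if p': "p' \<in> young_rows l - {p}" for p'
  proof -
    have "clock \<epsilon> \<omega> p \<le> clock \<epsilon> \<omega> p'" using p' p by (simp add: finite_rows)
    moreover have "clock \<epsilon> \<omega> p \<noteq> clock \<epsilon> \<omega> p'"
      using inj_onD[OF inj, of p p'] p' p(1) rows_subset[OF l(1)] by blast
    ultimately show ?thesis by simp
  qed
  with p show ?thesis by blast
qed

context
  fixes \<epsilon> :: "nat \<Rightarrow> nat \<Rightarrow> 'a \<Rightarrow> real" and \<tau> :: real and \<omega> :: 'a
begin

text \<open>The trajectory of the partition process for the fixed sample \<open>\<omega>\<close>.\<close>

abbreviation (input) path :: "real \<Rightarrow> nat multiset" where
  "path t \<equiv> random_partition \<epsilon> t \<omega>"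

lemma jump_chain_0: "jump_chain \<tau> path 0 = path \<tau>"
  by (simp add: jump_chain_def)

lemma jump_time_ge: "regular \<epsilon> \<omega> \<Longrightarrow> 0 < \<tau> \<Longrightarrow> \<tau> \<le> jump_time \<tau> path j"
proof (induction j)
  case (Suc j)
  let ?t = "jump_time \<tau> path j"
  show ?case
  proof (cases "\<exists>s>?t. path s \<noteq> path ?t")
    case True
    have "path ?t \<noteq> {#}"
    proof
      assume "path ?t = {#}"
      then have "path s = {#}" if "?t < s" for s
        using random_partition_antimono[of \<epsilon> \<omega> ?t s] Suc that by auto
      with \<open>path ?t = {#}\<close> True show False by auto
    qed
    with next_jump(1,2)[of \<epsilon> \<omega> ?t] Suc True show ?thesis by (auto simp: Let_def)
  qed (use Suc in \<open>auto simp: Let_def\<close>)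
qed simp

lemma jump_time_pos: "0 < \<tau> \<Longrightarrow> 0 < jump_time \<tau> path j"
proof (cases "regular \<epsilon> \<omega>")
  case False
  then have "jump_time \<tau> path j = \<tau>"
    by (induction j) (simp_all add: random_partition_not_regular)
  then show "0 < \<tau> \<Longrightarrow> ?thesis" by simp
qed (use jump_time_ge less_le_trans in blast)

lemma absorbed:
  assumes "0 < t" "path t = {#}" "t < s"
  shows "path s = {#}"
proof (cases "regular \<epsilon> \<omega>")
  case True
  with random_partition_antimono[OF True, of t s] assms show ?thesis by simp
qed (simp add: random_partition_not_regular)

lemma jump_chain_nonempty_regular: "jump_chain \<tau> path j \<noteq> {#} \<Longrightarrow> regular \<epsilon> \<omega>"
  by (rule ccontr) (simp add: jump_chain_def random_partition_not_regular)

lemma jump_time_Suc: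
  assumes "0 < \<tau>"
  shows "jump_time \<tau> path (Suc j) =
    (if jump_chain \<tau> path j = {#} then jump_time \<tau> path j
     else Min (clock \<epsilon> \<omega> ` young_rows (jump_chain \<tau> path j)))"
proof (cases "jump_chain \<tau> path j = {#}")
  case True
  have "\<not> (\<exists>s>jump_time \<tau> path j. path s \<noteq> path (jump_time \<tau> path j))"
    using absorbed[OF jump_time_pos[OF assms]] True by (metis jump_chain_def)
  with True show ?thesis
    by (simp only: jump_time.simps Let_def if_True if_False refl)
next
  case False
  then have "regular \<epsilon> \<omega>" by (rule jump_chain_nonempty_regular)
  from next_jump(2,4)[OF this jump_time_pos[OF assms] refl, of j] False show ?thesis
    by (simp only: jump_time.simps Let_def jump_chain_def if_True if_False not_False_eq_True)
qed

lemma jump_chain_Suc_empty: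
  assumes "0 < \<tau>" "jump_chain \<tau> path j = {#}"
  shows "jump_chain \<tau> path (Suc j) = {#}"
  using jump_time_Suc[OF assms(1), of j] assms(2) by (simp add: jump_chain_def)

lemma jump_chain_in_partitions: "0 < \<tau> \<Longrightarrow> jump_chain \<tau> path j \<in> partitions"
  unfolding jump_chain_def by (intro random_partition_in_partitions jump_time_pos)

lemma jump_chain_Suc_subset:
  assumes "0 < \<tau>" "jump_chain \<tau> path j \<noteq> {#}"
  shows "jump_chain \<tau> path (Suc j) \<subset># jump_chain \<tau> path j"
proof -
  have "regular \<epsilon> \<omega>" using assms(2) by (rule jump_chain_nonempty_regular)
  from next_jump(3)[OF this jump_time_pos[OF assms(1)] refl, of j] assms show ?thesis
    unfolding jump_chain_def by (subst jump_time_Suc) (auto simp: jump_chain_def)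
qed

text \<open>
  A jump of the path strictly decreases the number of parts, so the number of jumps is at most
  the initial number of parts.
\<close>

lemma num_jumps_finite: "0 < \<tau> \<Longrightarrow> num_jumps \<tau> path < \<infinity>"
  and jump_chain_empty_iff: "0 < \<tau> \<Longrightarrow> jump_chain \<tau> path j = {#} \<longleftrightarrow> num_jumps \<tau> path \<le> enat j"
proof -
  assume \<tau>: "0 < \<tau>"
  let ?L = "jump_chain \<tau> path"
  have stop: "{j. \<forall>s>jump_time \<tau> path j. path s = path (jump_time \<tau> path j)} = {j. ?L j = {#}}"
  proof (intro Collect_cong iffI allI impI)
    fix j assume *: "\<forall>s>jump_time \<tau> path j. path s = path (jump_time \<tau> path j)"
    show "?L j = {#}"
    proof (rule ccontr)
      assume ne: "?L j \<noteq> {#}"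
      then have "regular \<epsilon> \<omega>" by (rule jump_chain_nonempty_regular)
      from next_jump(4)[OF this jump_time_pos[OF \<tau>] refl, of j] ne * show False
        by (auto simp: jump_chain_def)
    qed
  next
    fix j s assume "?L j = {#}" "jump_time \<tau> path j < s"
    then show "path s = path (jump_time \<tau> path j)"
      using absorbed[OF jump_time_pos[OF \<tau>]] by (metis jump_chain_def)
  qed
  have size: "size (?L j) + j \<le> size (?L 0) \<or> ?L j = {#}" for j
  proof (induction j)
    case (Suc j)
    show ?case
    proof (cases "?L j = {#}")
      case True
      then show ?thesis using jump_chain_Suc_empty[OF \<tau>] by blast
    next
      case False
      with Suc mset_subset_size[OF jump_chain_Suc_subset[OF \<tau> False]] show ?thesis by simp
    qed
  qed simp
  have "?L (Suc (size (?L 0))) = {#}"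
    using size[of "Suc (size (?L 0))"] by auto
  then have "num_jumps \<tau> path \<le> enat (Suc (size (?L 0)))"
    unfolding num_jumps_def stop by (intro INF_lower) simp
  then show fin: "num_jumps \<tau> path < \<infinity>"
    by (cases "num_jumps \<tau> path") auto
  then obtain n where n: "num_jumps \<tau> path = enat n" by auto
  then have "?L n = {#}" "\<forall>i<n. ?L i \<noteq> {#}"
    using enat_eq_INF_iff[of n "{j. ?L j = {#}}"] unfolding num_jumps_def stop by auto
  moreover have "?L i = {#}" if "n \<le> i" for i
    using that \<open>?L n = {#}\<close> by (induction rule: dec_induct) (auto intro: jump_chain_Suc_empty[OF \<tau>])
  ultimately show "?L j = {#} \<longleftrightarrow> num_jumps \<tau> path \<le> enat j"
    by (auto simp: n not_less[symmetric])
qed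

text \<open>
  The state after a jump determines the row whose clock caused it, by \<open>strike_inject\<close>. Without
  simultaneous rings this gives an equivalence.
\<close>

lemma jump_chain_Suc_eq_strike_iff:
  assumes reg: "regular \<epsilon> \<omega>" and \<tau>: "0 < \<tau>"
    and inj: "inj_on (clock \<epsilon> \<omega>) ({1..} \<times> {1..})"
    and l: "jump_chain \<tau> path j = l" and q: "q \<in> young_rows l"
  shows "jump_chain \<tau> path (Suc j) = strike l q \<longleftrightarrow> (\<forall>p\<in>young_rows l - {q}. clock \<epsilon> \<omega> q < clock \<epsilon> \<omega> p)"
proof -
  have ne: "l \<noteq> {#}" using q by (auto simp: rows_eq_empty_iff[symmetric])
  have lp: "l \<in> partitions" using jump_chain_in_partitions[OF \<tau>, of j] l by simp
  obtain p where p: "p \<in> young_rows l" "clock \<epsilon> \<omega> p = Min (clock \<epsilon> \<omega> ` young_rows l)"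
      "\<And>p'. p' \<in> young_rows l - {p} \<Longrightarrow> clock \<epsilon> \<omega> p < clock \<epsilon> \<omega> p'"
    using first_clock[OF inj lp ne] by blast
  have "jump_chain \<tau> path (Suc j) = path (clock \<epsilon> \<omega> p)"
    using jump_time_Suc[OF \<tau>, of j] l ne p by (simp add: jump_chain_def)
  also have "\<dots> = strike l p"
    using random_partition_first_ring[OF reg jump_time_pos[OF \<tau>], of j l p] l p
    by (simp add: jump_chain_def)
  finally have "jump_chain \<tau> path (Suc j) = strike l q \<longleftrightarrow> q = p"
    using strike_inject[OF q p(1)] by auto
  also have "\<dots> \<longleftrightarrow> (\<forall>p\<in>young_rows l - {q}. clock \<epsilon> \<omega> q < clock \<epsilon> \<omega> p)"
    using p(1,3) q by (metis Diff_iff insertE less_asym singletonD insertCI)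
  finally show ?thesis .
qed

lemma jump_chain_Suc_strike:
  assumes "regular \<epsilon> \<omega>" "0 < \<tau>" "inj_on (clock \<epsilon> \<omega>) ({1..} \<times> {1..})" "jump_chain \<tau> path j \<noteq> {#}"
  shows "\<exists>q\<in>young_rows (jump_chain \<tau> path j). jump_chain \<tau> path (Suc j) = strike (jump_chain \<tau> path j) q"
proof -
  obtain p where p: "p \<in> young_rows (jump_chain \<tau> path j)"
      "\<forall>p'\<in>young_rows (jump_chain \<tau> path j) - {p}. clock \<epsilon> \<omega> p < clock \<epsilon> \<omega> p'"
    using first_clock[OF assms(3) jump_chain_in_partitions[OF assms(2)] assms(4)] by blast
  with jump_chain_Suc_eq_strike_iff[OF assms(1-3) refl p(1)] p show ?thesis by blast
qed

text \<open>
  For regular samples without simultaneous rings, the chain follows a prescribed sequence of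
  deletions if and only if it starts in the right state and in every state of the sequence the
  prescribed row is the first of the present ones to ring.
\<close>

lemma jump_chain_path_iff:
  assumes "regular \<epsilon> \<omega>" "0 < \<tau>" "inj_on (clock \<epsilon> \<omega>) ({1..} \<times> {1..})"
    and "\<And>i. i < m \<Longrightarrow> r i \<in> young_rows (x i) \<and> x (Suc i) = strike (x i) (r i)"
  shows "(\<forall>i\<le>m. jump_chain \<tau> path i = x i) \<longleftrightarrow>
    jump_chain \<tau> path 0 = x 0 \<and>
    (\<forall>i<m. \<forall>q\<in>young_rows (x i) - {r i}. clock \<epsilon> \<omega> (r i) < clock \<epsilon> \<omega> q)"
  using assms(4)
proof (induction m)
  case (Suc m)
  have "(\<forall>i\<le>Suc m. jump_chain \<tau> path i = x i) \<longleftrightarrow>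
      (\<forall>i\<le>m. jump_chain \<tau> path i = x i) \<and> jump_chain \<tau> path (Suc m) = x (Suc m)"
    by (auto simp: le_Suc_eq)
  also have "\<dots> \<longleftrightarrow> (\<forall>i\<le>m. jump_chain \<tau> path i = x i) \<and>
      (\<forall>q\<in>young_rows (x m) - {r m}. clock \<epsilon> \<omega> (r m) < clock \<epsilon> \<omega> q)"
    using jump_chain_Suc_eq_strike_iff[OF assms(1-3), of m "x m" "r m"] Suc.prems[of m] by auto
  finally show ?case
    using Suc.IH Suc.prems by (auto simp: less_Suc_eq)
qed simp

end

section \<open>The update rule\<close>

lemma mset_parts: "mset (parts l) = l"
  by (simp add: parts_def)

lemma mset_nths_compl:
  "mset (nths xs (- {i. i \<le> y \<and> xs ! i = v})) =
    mset xs - replicate_mset (card {i. i < length xs \<and> i \<le> y \<and> xs ! i = v}) v"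
proof (induction xs rule: rev_induct)
  case (snoc x xs)
  let ?n = "length xs"
  let ?S = "\<lambda>ys. {i. i < length ys \<and> i \<le> y \<and> ys ! i = v}"
  have S: "?S (xs @ [x]) = ?S xs \<union> (if ?n \<le> y \<and> x = v then {?n} else {})"
    by (auto simp: nth_append less_Suc_eq)
  have "nths xs (- {i. i \<le> y \<and> (xs @ [x]) ! i = v}) = nths xs (- {i. i \<le> y \<and> xs ! i = v})"
    unfolding nths_def
    by (intro arg_cong[of _ _ "map fst"] filter_cong) (auto simp: set_zip nth_append)
  moreover have "count (mset xs) v \<ge> card (?S xs)"
  proof -
    have "card (?S xs) \<le> card {i. i < length xs \<and> xs ! i = v}"
      by (intro card_mono) auto
    also have "\<dots> = count (mset xs) v"
      by (simp add: count_mset count_list_eq_length_filter length_filter_conv_card eq_commute[of _ v])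
    finally show ?thesis .
  qed
  ultimately show ?case
    using snoc unfolding S
    by (intro multiset_eqI) (auto simp: nths_append card_insert_if Suc_diff_le)
qed simp

text \<open>The rank of row \<open>y\<close> among the rows of its own length, counted from the bottom.\<close>

definition row_rank :: "nat multiset \<Rightarrow> nat \<Rightarrow> nat" where
  "row_rank l y = card {i. i < length (parts l) \<and> i \<le> y \<and> parts l ! i = parts l ! y}"

lemma remove_rows_eq:
  "remove_rows l (x, y) = l - replicate_mset (row_rank l y) (parts l ! y)"
  by (simp add: remove_rows_def mset_nths_compl mset_parts row_rank_def)

lemma row_rank_bij:
  "bij_betw (row_rank l) {y. y < length (parts l) \<and> parts l ! y = k} {1..count l k}"
proof -
  let ?O = "{y. y < length (parts l) \<and> parts l ! y = k}"
  have rank: "row_rank l y = card (?O \<inter> {..y})" if "y \<in> ?O" for y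
    unfolding row_rank_def using that by (intro arg_cong[of _ _ card]) auto
  have less: "row_rank l y < row_rank l z" if "y \<in> ?O" "z \<in> ?O" "y < z" for y z
  proof -
    have "?O \<inter> {..y} \<subseteq> ?O \<inter> {..z}" "z \<in> ?O \<inter> {..z}" "z \<notin> ?O \<inter> {..y}"
      using that by auto
    then have "?O \<inter> {..y} \<subset> ?O \<inter> {..z}" by blast
    then show ?thesis unfolding rank[OF that(1)] rank[OF that(2)] by (intro psubset_card_mono) simp
  qed
  have inj: "inj_on (row_rank l) ?O"
  proof (rule inj_onI)
    fix y z assume "y \<in> ?O" "z \<in> ?O" "row_rank l y = row_rank l z"
    then show "y = z"
      using less[of y z] less[of z y] by (cases y z rule: linorder_cases) simp_all
  qed
  have card: "card ?O = count l k"
  proof -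
    have "card ?O = count (mset (parts l)) k"
      by (simp add: count_mset count_list_eq_length_filter length_filter_conv_card eq_commute[of _ k])
    then show ?thesis by (simp only: mset_parts)
  qed
  have "row_rank l ` ?O \<subseteq> {1..count l k}"
  proof (intro image_subsetI)
    fix y assume y: "y \<in> ?O"
    have "card (?O \<inter> {..y}) \<le> card ?O" by (intro card_mono) auto
    moreover have "card (?O \<inter> {..y}) > 0" using y by (auto simp: card_gt_0_iff)
    ultimately show "row_rank l y \<in> {1..count l k}" using rank[OF y] card by simp
  qed
  moreover have "card (row_rank l ` ?O) = card {1..count l k}"
    using card inj by (simp add: card_image)
  ultimately have "row_rank l ` ?O = {1..count l k}"
    by (intro card_subset_eq) auto
  with inj show ?thesis by (simp add: bij_betw_def)
qed

lemma young_diagram_eq_Sigma: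
  "young_diagram l = (\<lambda>(y, x). (x, y)) ` (SIGMA y:{..<length (parts l)}. {..<parts l ! y})"
  by (auto simp: young_diagram_def image_iff)

lemma finite_young_diagram: "finite (young_diagram l)"
  by (simp add: young_diagram_eq_Sigma)

lemma card_young_diagram: "card (young_diagram l) = sum_mset l"
proof -
  have "card (young_diagram l) = (\<Sum>y<length (parts l). parts l ! y)"
    unfolding young_diagram_eq_Sigma by (subst card_image) (auto simp: inj_on_def)
  also have "\<dots> = sum_mset (mset (parts l))"
    by (simp only: sum_mset_sum_list sum_list_sum_nth lessThan_atLeast0)
  finally show ?thesis by (simp only: mset_parts)
qed

lemma young_diagram_nonempty: "l \<in> partitions \<Longrightarrow> l \<noteq> {#} \<Longrightarrow> young_diagram l \<noteq> {}"
  using card_young_diagram[of l] finite_young_diagram[of l]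
  by (auto simp: partitions_iff) (metis gr0I multiset_nonemptyE)

lemma diff_replicate_inject:
  assumes "1 \<le> r" "r \<le> count l k" "1 \<le> r'" "r' \<le> count l k'"
    and "l - replicate_mset r k = l - replicate_mset r' k'"
  shows "k = k' \<and> r = r'"
proof -
  have diff: "count l i - (if i = k then r else 0) = count l i - (if i = k' then r' else 0)" for i
    using arg_cong[OF assms(5), of "\<lambda>m. count m i"] by (simp only: count_diff count_replicate_mset)
  have "k = k'"
  proof (rule ccontr)
    assume "k \<noteq> k'"
    with diff[of k] assms(1,2) show False by simp
  qed
  moreover from this have "r = r'"
    using diff[of k] assms(1-4) by simp
  ultimately show ?thesis by simp
qed

text \<open>
  The boxes whose choice removes exactly \<open>r\<close> rows of length \<open>k\<close> are the \<open>k\<close> boxes of the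
  \<open>r\<close>-th row of that length.
\<close>

lemma pmf_update_rule:
  assumes l: "l \<in> partitions" and r: "1 \<le> r" "r \<le> count l k"
  shows "pmf (update_rule l) (l - replicate_mset r k) = real k / real (sum_mset l)"
proof -
  have ne: "l \<noteq> {#}" using r by auto
  obtain y0 where y0: "y0 < length (parts l)" "parts l ! y0 = k" "row_rank l y0 = r"
  proof -
    have "r \<in> row_rank l ` {y. y < length (parts l) \<and> parts l ! y = k}"
      using row_rank_bij[of l k] r by (simp add: bij_betw_def)
    then show ?thesis using that by auto
  qed
  have "{b \<in> young_diagram l. remove_rows l b = l - replicate_mset r k} = {..<k} \<times> {y0}"
  proof (intro set_eqI iffI)
    fix b assume b: "b \<in> {b \<in> young_diagram l. remove_rows l b = l - replicate_mset r k}"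
    obtain x y where xy: "b = (x, y)" by fastforce
    have y: "y < length (parts l)" "x < parts l ! y" using b by (auto simp: xy young_diagram_def)
    have "row_rank l y \<in> {1..count l (parts l ! y)}"
      using y row_rank_bij[of l "parts l ! y"] by (auto simp: bij_betw_def)
    then have "parts l ! y = k \<and> row_rank l y = r"
      using b r by (intro diff_replicate_inject[of _ l]) (auto simp: xy remove_rows_eq)
    moreover from this have "y = y0"
      using y0 y row_rank_bij[of l k] by (auto simp: bij_betw_def dest: inj_onD)
    ultimately show "b \<in> {..<k} \<times> {y0}" using y by (auto simp: xy)
  next
    fix b assume "b \<in> {..<k} \<times> {y0}"
    then show "b \<in> {b \<in> young_diagram l. remove_rows l b = l - replicate_mset r k}"
      using y0 by (auto simp: young_diagram_def remove_rows_eq)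
  qed
  then have "card {b \<in> young_diagram l. remove_rows l b = l - replicate_mset r k} = k"
    by (simp add: card_cartesian_product)
  then show ?thesis
    using ne l
    by (simp add: update_rule_def pmf_map measure_pmf_of_set young_diagram_nonempty
        finite_young_diagram card_young_diagram vimage_def Int_def conj_commute)
qed

lemma pmf_update_rule_eq_0:
  assumes l: "l \<in> partitions" "l \<noteq> {#}"
    and no: "\<nexists>k r. 1 \<le> r \<and> r \<le> count l k \<and> m = l - replicate_mset r k"
  shows "pmf (update_rule l) m = 0"
proof -
  have "m \<notin> remove_rows l ` young_diagram l"
  proof
    assume "m \<in> remove_rows l ` young_diagram l"
    then obtain x y where y: "y < length (parts l)" "m = remove_rows l (x, y)"
      by (auto simp: young_diagram_def)
    then have "row_rank l y \<in> {1..count l (parts l ! y)}"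
      using row_rank_bij[of l "parts l ! y"] by (auto simp: bij_betw_def)
    with no y show False by (auto simp: remove_rows_eq)
  qed
  then show ?thesis
    using l by (simp add: update_rule_def pmf_eq_0_set_pmf young_diagram_nonempty finite_young_diagram)
qed

lemma pmf_update_rule_strike:
  assumes "l \<in> partitions" "q \<in> young_rows l"
  shows "pmf (update_rule l) (strike l q) = real (fst q) / real (sum_mset l)"
  using pmf_update_rule[OF assms(1), of "Suc (count l (fst q)) - snd q" "fst q"] assms(2)
  by (auto simp: strike_def young_rows_def)

text \<open>The explicit form of the transition probabilities.\<close>

lemma update_rule_transitions:
  assumes "1 \<le> n" "l \<in> partitions_of n"
  shows "(\<forall>\<kappa> r. 1 \<le> r \<and> r \<le> count l \<kappa> \<and> m = l - replicate_mset r \<kappa> \<longrightarrow>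
      pmf (update_rule l) m = real \<kappa> / real n) \<and>
    ((\<nexists>\<kappa> r. 1 \<le> r \<and> r \<le> count l \<kappa> \<and> m = l - replicate_mset r \<kappa>) \<longrightarrow>
      pmf (update_rule l) m = 0)"
proof -
  have l: "l \<in> partitions" "sum_mset l = n" "l \<noteq> {#}"
    using assms by (auto simp: partitions_def partitions_of_def)
  show ?thesis
    using pmf_update_rule[OF l(1)] pmf_update_rule_eq_0[OF l(1,3), of m] l(2) by blast
qed


section \<open>Independent exponential variables\<close>

text \<open>The probabilistic setting: independent rate-one exponential variables, observed from \<open>\<tau>\<close> on.\<close>

locale exponential_clocks = prob_space M for M :: "'a measure" +
  fixes \<epsilon> :: "nat \<Rightarrow> nat \<Rightarrow> 'a \<Rightarrow> real" and \<tau> :: real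
  assumes indep: "indep_vars (\<lambda>_. borel) (\<lambda>(k, j). \<epsilon> k j) ({1..} \<times> {1..})"
    and exponential: "\<And>k j. k \<ge> 1 \<Longrightarrow> j \<ge> 1 \<Longrightarrow> distributed M lborel (\<epsilon> k j) (exponential_density 1)"
    and tau_pos: "\<tau> > 0"
begin

lemma measurable_clock: "q \<in> {1..} \<times> {1..} \<Longrightarrow> (\<lambda>\<omega>. clock \<epsilon> \<omega> q) \<in> borel_measurable M"
proof -
  assume "q \<in> {1..} \<times> {1..}"
  then have "distributed M lborel (\<epsilon> (fst q) (snd q)) (exponential_density 1)"
    by (intro exponential) auto
  from distributed_measurable[OF this] show ?thesis
    unfolding clock_def by simp
qed

lemma measurable_clock_Suc[measurable]: "(\<lambda>\<omega>. clock \<epsilon> \<omega> (Suc k, Suc j)) \<in> borel_measurable M"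
  by (rule measurable_clock) simp

text \<open>
  The law of the race, transported to the underlying space. The clocks of \<open>R 0\<close> run at time
  \<open>s\<close>, while those of \<open>I - R 0\<close> have rung by then.
\<close>

lemma prob_race:
  assumes I: "finite I" "I \<subseteq> {1..} \<times> {1..}" "R 0 \<subseteq> I" and s: "0 \<le> s"
    and chain: "\<And>i. i < m \<Longrightarrow> r i \<in> R i \<and> R (Suc i) \<subseteq> R i - {r i}"
  shows "prob {\<omega> \<in> space M. (\<forall>q\<in>I - R 0. clock \<epsilon> \<omega> q \<le> s) \<and> (\<forall>q\<in>R 0. s < clock \<epsilon> \<omega> q) \<and>
      (\<forall>i<m. \<forall>q\<in>R i - {r i}. clock \<epsilon> \<omega> (r i) < clock \<epsilon> \<omega> q)} =
    (\<Prod>q\<in>I - R 0. 1 - exp (- s * real (fst q))) * exp (- s * (\<Sum>q\<in>R 0. real (fst q))) *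
      (\<Prod>i<m. real (fst (r i)) / (\<Sum>q\<in>R i. real (fst q)))"
proof (cases "I = {}")
  case True
  then have "R 0 = {}" "m = 0" using I(3) chain[of 0] by (cases m; auto)+
  then show ?thesis using True by (simp add: prob_space)
next
  case False
  define X where "X q = \<epsilon> (fst q) (snd q)" for q
  have rv: "random_variable borel (X q)" and distr: "distr M borel (X q) = Exp1" if "q \<in> I" for q
  proof -
    have d: "distributed M lborel (X q) (exponential_density 1)"
      using that I(2) unfolding X_def by (intro exponential) auto
    from distributed_measurable[OF d] show "random_variable borel (X q)" by simp
    have "distr M borel (X q) = distr M lborel (X q)" by (intro distr_cong) auto
    also have "\<dots> = Exp1" by (rule distributed_distr_eq_density[OF d])
    finally show "distr M borel (X q) = Exp1" .
  qed
  have "indep_vars (\<lambda>_. borel) X I"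
    using indep_vars_subset[OF indep I(2)] by (simp add: X_def[abs_def] case_prod_beta')
  then have joint: "distr M (\<Pi>\<^sub>M q\<in>I. borel) (\<lambda>\<omega>. \<lambda>q\<in>I. X q \<omega>) = (\<Pi>\<^sub>M q\<in>I. Exp1)"
    using indep_vars_iff_distr_eq_PiM'[where I = I and M' = "\<lambda>_. borel" and X = X] False rv distr
    by (simp cong: PiM_cong)
  have dec: "R i \<subseteq> R 0" if "i \<le> m" for i
    using that
  proof (induction i)
    case (Suc i)
    then show ?case using chain[of i] by auto
  qed simp
  define A where "A = {x \<in> space (\<Pi>\<^sub>M q\<in>I. Exp1). (\<forall>q\<in>I - R 0. x q \<in> {..s * real (fst q)}) \<and>
      (\<forall>q\<in>R 0. s * real (fst q) < x q) \<and>
      (\<forall>i<m. \<forall>q\<in>R i - {r i}. x (r i) / real (fst (r i)) < x q / real (fst q))}"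
  have "A \<in> sets (\<Pi>\<^sub>M q\<in>I. Exp1)"
    unfolding A_def using I chain dec by (intro sets_race) auto
  then have A: "A \<in> sets (\<Pi>\<^sub>M q\<in>I. borel)"
    by (simp cong: sets_PiM_cong)
  have "{\<omega> \<in> space M. (\<forall>q\<in>I - R 0. clock \<epsilon> \<omega> q \<le> s) \<and> (\<forall>q\<in>R 0. s < clock \<epsilon> \<omega> q) \<and>
      (\<forall>i<m. \<forall>q\<in>R i - {r i}. clock \<epsilon> \<omega> (r i) < clock \<epsilon> \<omega> q)} =
    (\<lambda>\<omega>. \<lambda>q\<in>I. X q \<omega>) -` A \<inter> space M" (is "?E = _")
  proof -
    have "(\<lambda>q\<in>I. X q \<omega>) \<in> A \<longleftrightarrow> (\<forall>q\<in>I - R 0. clock \<epsilon> \<omega> q \<le> s) \<and> (\<forall>q\<in>R 0. s < clock \<epsilon> \<omega> q) \<and>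
      (\<forall>i<m. \<forall>q\<in>R i - {r i}. clock \<epsilon> \<omega> (r i) < clock \<epsilon> \<omega> q)" for \<omega>
    proof -
      have pos: "0 < real (fst q)" if "q \<in> I" for q using that I(2) by auto
      have sides: "(\<forall>q\<in>I - R 0. (\<lambda>q\<in>I. X q \<omega>) q \<in> {..s * real (fst q)}) \<longleftrightarrow> (\<forall>q\<in>I - R 0. clock \<epsilon> \<omega> q \<le> s)"
        using pos by (intro ball_cong) (auto simp: clock_def X_def pos_divide_le_eq)
      have start: "(\<forall>q\<in>R 0. s * real (fst q) < (\<lambda>q\<in>I. X q \<omega>) q) \<longleftrightarrow> (\<forall>q\<in>R 0. s < clock \<epsilon> \<omega> q)"
        using pos I(3) by (intro ball_cong) (auto simp: clock_def X_def pos_less_divide_eq subset_iff)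
      have round: "(\<forall>q\<in>R i - {r i}. (\<lambda>q\<in>I. X q \<omega>) (r i) / real (fst (r i)) < (\<lambda>q\<in>I. X q \<omega>) q / real (fst q)) \<longleftrightarrow>
          (\<forall>q\<in>R i - {r i}. clock \<epsilon> \<omega> (r i) < clock \<epsilon> \<omega> q)" if "i < m" for i
      proof -
        have "R i \<subseteq> I" "r i \<in> I" using chain[OF that] dec[of i] that I(3) by auto
        then show ?thesis by (intro ball_cong) (auto simp: clock_def X_def)
      qed
      have sp: "(\<lambda>q\<in>I. X q \<omega>) \<in> space (\<Pi>\<^sub>M q\<in>I. Exp1)"
        by (simp add: space_PiM)
      have rounds: "(\<forall>i<m. \<forall>q\<in>R i - {r i}. (\<lambda>q\<in>I. X q \<omega>) (r i) / real (fst (r i)) <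
            (\<lambda>q\<in>I. X q \<omega>) q / real (fst q)) \<longleftrightarrow>
          (\<forall>i<m. \<forall>q\<in>R i - {r i}. clock \<epsilon> \<omega> (r i) < clock \<epsilon> \<omega> q)"
        by (intro all_cong round)
      show ?thesis
        unfolding A_def mem_Collect_eq sides start rounds by (simp only: sp simp_thms)
    qed
    then show ?thesis by auto
  qed
  then have "emeasure M ?E = emeasure (\<Pi>\<^sub>M q\<in>I. Exp1) A"
    unfolding joint[symmetric] using A rv by (subst emeasure_distr) (auto intro!: measurable_restrict)
  also have "\<dots> = (\<Prod>q\<in>I - R 0. emeasure Exp1 {..s * real (fst q)}) *
      ennreal (exp (- s * (\<Sum>q\<in>R 0. real (fst q))) * (\<Prod>i<m. real (fst (r i)) / (\<Sum>q\<in>R i. real (fst q))))"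
    unfolding A_def using I s chain by (intro emeasure_race) auto
  also have "(\<Prod>q\<in>I - R 0. emeasure Exp1 {..s * real (fst q)}) =
      (\<Prod>q\<in>I - R 0. ennreal (1 - exp (- s * real (fst q))))"
    using s by (intro prod.cong) (auto simp: emeasure_Exp1_atMost)
  also have "\<dots> = ennreal (\<Prod>q\<in>I - R 0. 1 - exp (- s * real (fst q)))"
    using s by (intro prod_ennreal) auto
  also have "ennreal (\<Prod>q\<in>I - R 0. 1 - exp (- s * real (fst q))) *
      ennreal (exp (- s * (\<Sum>q\<in>R 0. real (fst q))) * (\<Prod>i<m. real (fst (r i)) / (\<Sum>q\<in>R i. real (fst q)))) =
      ennreal ((\<Prod>q\<in>I - R 0. 1 - exp (- s * real (fst q))) *
      (exp (- s * (\<Sum>q\<in>R 0. real (fst q))) * (\<Prod>i<m. real (fst (r i)) / (\<Sum>q\<in>R i. real (fst q)))))"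
    using s by (intro ennreal_mult[symmetric])
      (auto intro!: prod_nonneg mult_nonneg_nonneg divide_nonneg_nonneg sum_nonneg)
  finally have "prob ?E = (\<Prod>q\<in>I - R 0. 1 - exp (- s * real (fst q))) *
      (exp (- s * (\<Sum>q\<in>R 0. real (fst q))) * (\<Prod>i<m. real (fst (r i)) / (\<Sum>q\<in>R i. real (fst q))))"
    using s by (intro measure_eq_emeasure_eq_ennreal)
      (auto intro!: prod_nonneg mult_nonneg_nonneg divide_nonneg_nonneg sum_nonneg)
  then show ?thesis by (simp only: mult.assoc)
qed

lemma prob_all_late:
  assumes "finite I" "I \<subseteq> {1..} \<times> {1..}" "0 \<le> s"
  shows "prob {\<omega> \<in> space M. \<forall>q\<in>I. s < clock \<epsilon> \<omega> q} = exp (- s * (\<Sum>q\<in>I. real (fst q)))"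
  using prob_race[of I "\<lambda>_. I" s 0] assms by simp

subsection \<open>Almost sure regularity\<close>

text \<open>The two ways of ordering a pair of clocks strictly have total probability one.\<close>

lemma AE_clock_neq:
  assumes "p \<in> {1..} \<times> {1..}" "q \<in> {1..} \<times> {1..}" "p \<noteq> q"
  shows "AE \<omega> in M. clock \<epsilon> \<omega> p \<noteq> clock \<epsilon> \<omega> q"
proof -
  note [measurable] = measurable_clock[OF assms(1)] measurable_clock[OF assms(2)]
  define E where "E p q = {\<omega> \<in> space M. 0 < clock \<epsilon> \<omega> p \<and> 0 < clock \<epsilon> \<omega> q \<and> clock \<epsilon> \<omega> p < clock \<epsilon> \<omega> q}"
    for p q
  have prob: "prob (E p q) = real (fst p) / (real (fst p) + real (fst q))"
    if "p \<in> {1..} \<times> {1..}" "q \<in> {1..} \<times> {1..}" "p \<noteq> q" for p q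
  proof -
    have "E p q = {\<omega> \<in> space M. (\<forall>x\<in>{p, q} - {p, q}. clock \<epsilon> \<omega> x \<le> 0) \<and>
        (\<forall>x\<in>{p, q}. 0 < clock \<epsilon> \<omega> x) \<and> (\<forall>i<Suc 0. \<forall>x\<in>{p, q} - {p}. clock \<epsilon> \<omega> p < clock \<epsilon> \<omega> x)}"
      using that(3) by (auto simp: E_def)
    also have "prob \<dots> = real (fst p) / (real (fst p) + real (fst q))"
      using prob_race[of "{p, q}" "\<lambda>i. if i = 0 then {p, q} else {}" 0 "Suc 0" "\<lambda>_. p"] that
      by simp
    finally show ?thesis .
  qed
  have "prob (E p q \<union> E q p) = prob (E p q) + prob (E q p)"
    by (intro finite_measure_Union) (auto simp: E_def)
  also have "\<dots> = 1"
  proof -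
    have "0 < real (fst p)" using assms(1) by auto
    then show ?thesis
      using assms by (simp add: prob add_divide_distrib[symmetric] add.commute[of "real (fst q)"])
  qed
  finally have "AE \<omega> in M. \<omega> \<in> E p q \<union> E q p"
    by (rule AE_prob_1)
  then show ?thesis by eventually_elim (auto simp: E_def)
qed

lemma AE_inj_on_clock: "AE \<omega> in M. inj_on (clock \<epsilon> \<omega>) ({1..} \<times> {1..})"
proof -
  have "AE \<omega> in M. \<forall>p q. p \<in> {1..} \<times> {1..} \<longrightarrow> q \<in> {1..} \<times> {1..} \<longrightarrow> p \<noteq> q \<longrightarrow>
      clock \<epsilon> \<omega> p \<noteq> clock \<epsilon> \<omega> q"
    unfolding AE_all_countable using AE_clock_neq by (intro allI) (simp add: AE_clock_neq)
  then show ?thesis by eventually_elim (auto simp: inj_on_def)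
qed

text \<open>
  The probability that a clock of rate \<open>k\<close> rings after \<open>c\<close> is \<open>exp (- c)\<close> to the power \<open>k\<close>,
  which is summable over \<open>k\<close>.
\<close>

lemma AE_eventually_early:
  assumes c: "0 < c"
  shows "AE \<omega> in M. \<forall>\<^sub>F k in sequentially. clock \<epsilon> \<omega> (Suc k, Suc 0) \<le> c"
proof -
  define A where "A k = {\<omega> \<in> space M. c < clock \<epsilon> \<omega> (Suc k, Suc 0)}" for k
  have "prob (A k) = exp (- c) ^ Suc k" for k
    using prob_all_late[of "{(Suc k, Suc 0)}" c] c
    unfolding exp_of_nat_mult[symmetric] by (simp add: A_def mult.commute)
  moreover have "summable (\<lambda>k. exp (- c) ^ Suc k)"
    using c by (subst summable_Suc_iff) (simp add: summable_geometric)
  ultimately have "AE \<omega> in M. \<forall>\<^sub>F k in sequentially. \<omega> \<in> space M - A k"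
    by (intro borel_cantelli_AE1) (auto simp: A_def emeasure_eq_measure)
  then show ?thesis
    by eventually_elim (auto simp: A_def not_less elim!: eventually_mono)
qed

text \<open>
  By independence, \<open>J\<close> clocks of the same rate \<open>k\<close> all ring after \<open>c\<close> with probability
  \<open>exp (- c k)\<close> to the power \<open>J\<close>, which tends to zero.
\<close>

lemma AE_ex_early:
  assumes c: "0 < c"
  shows "AE \<omega> in M. \<exists>j. clock \<epsilon> \<omega> (Suc k, Suc j) \<le> c"
proof -
  define N where "N = {\<omega> \<in> space M. \<forall>j. c < clock \<epsilon> \<omega> (Suc k, Suc j)}"
  have N_sets: "N \<in> sets M" unfolding N_def by measurable
  have "prob N \<le> exp (- c * real (Suc k)) ^ J" for J
  proof -
    let ?I = "(\<lambda>j. (Suc k, Suc j)) ` {..<J}"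
    have meas: "{\<omega> \<in> space M. \<forall>q\<in>?I. c < clock \<epsilon> \<omega> q} \<in> sets M"
      by simp
    have "prob N \<le> prob {\<omega> \<in> space M. \<forall>q\<in>?I. c < clock \<epsilon> \<omega> q}"
      by (intro finite_measure_mono meas) (auto simp: N_def)
    also have "\<dots> = exp (- c * (\<Sum>q\<in>?I. real (fst q)))"
      using c by (intro prob_all_late) auto
    also have "(\<Sum>q\<in>?I. real (fst q)) = real J * real (Suc k)"
      by (subst sum.reindex) (auto simp: inj_on_def)
    also have "exp (- c * (real J * real (Suc k))) = exp (- c * real (Suc k)) ^ J"
      by (simp only: exp_of_nat_mult[symmetric] mult_ac)
    finally show ?thesis .
  qed
  moreover have "(\<lambda>J. exp (- c * real (Suc k)) ^ J) \<longlonglongrightarrow> 0"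
    using c by (intro LIMSEQ_power_zero) simp
  ultimately have "prob N \<le> 0"
    by (intro LIMSEQ_le_const[where X="\<lambda>J. exp (- c * real (Suc k)) ^ J"]) auto
  then have "AE \<omega> in M. \<omega> \<notin> N"
    using N_sets by (subst AE_iff_measurable[of N]) (auto simp: emeasure_eq_measure measure_le_0_iff N_def)
  then show ?thesis
    by (rule AE_mp) (auto simp: N_def not_less)
qed

lemma AE_regular: "AE \<omega> in M. regular \<epsilon> \<omega>"
proof -
  have "AE \<omega> in M. \<forall>n. (\<forall>k. \<exists>j. clock \<epsilon> \<omega> (Suc k, Suc j) \<le> inverse (real (Suc n))) \<and>
      (\<forall>\<^sub>F k in sequentially. clock \<epsilon> \<omega> (Suc k, Suc 0) \<le> inverse (real (Suc n)))"
    unfolding AE_all_countable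
    by (intro allI AE_conjI AE_eventually_early) (simp_all add: AE_all_countable AE_ex_early)
  then show ?thesis by (simp add: regular_iff)
qed

subsection \<open>Measurability of the jump chain\<close>

lemma pred_regular[measurable]: "Measurable.pred M (regular \<epsilon>)"
  unfolding regular_iff[abs_def] eventually_sequentially by measurable

lemma countable_partitions: "countable partitions"
  by (rule countable_subset[OF subset_UNIV])
    (metis countable_image[of UNIV mset] countableI_type surj_mset)

text \<open>
  For regular samples, the state at a random time \<open>S\<close> is a given partition if and only if
  countably many inequalities between \<open>S\<close> and the clocks hold. Hence measurability holds
  without any appeal to the regularity of the path in time.
\<close>

lemma measurable_random_partition:
  assumes S[measurable]: "S \<in> borel_measurable M" and pos: "\<And>\<omega>. 0 < S \<omega>"
  shows "(\<lambda>\<omega>. random_partition \<epsilon> (S \<omega>) \<omega>) \<in> measurable M (count_space partitions)"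
proof (subst measurable_count_space_eq_countable[OF countable_partitions], intro conjI ballI)
  show "(\<lambda>\<omega>. random_partition \<epsilon> (S \<omega>) \<omega>) \<in> space M \<rightarrow> partitions"
    using pos by (auto intro: random_partition_in_partitions)
  fix l assume l: "l \<in> partitions"
  have eq: "random_partition \<epsilon> (S \<omega>) \<omega> = l \<longleftrightarrow>
      (if regular \<epsilon> \<omega> then (\<forall>q\<in>young_rows l. S \<omega> < clock \<epsilon> \<omega> q) \<and>
         (\<forall>k. clock \<epsilon> \<omega> (Suc k, Suc (count l (Suc k))) \<le> S \<omega>)
       else l = {#})" for \<omega>
  proof (cases "regular \<epsilon> \<omega>")
    case True
    with l show ?thesis
      by (simp only: random_partition_eq_iff[OF True pos] has_multiplicities_iff all_ge_1_iff if_True simp_thms)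
  qed (auto simp: random_partition_not_regular)
  have "(\<lambda>\<omega>. random_partition \<epsilon> (S \<omega>) \<omega>) -` {l} \<inter> space M =
      {\<omega> \<in> space M. random_partition \<epsilon> (S \<omega>) \<omega> = l}" by auto
  also have "\<dots> = {\<omega> \<in> space M.
      if regular \<epsilon> \<omega> then (\<forall>q\<in>young_rows l. S \<omega> < clock \<epsilon> \<omega> q) \<and>
         (\<forall>k. clock \<epsilon> \<omega> (Suc k, Suc (count l (Suc k))) \<le> S \<omega>)
       else l = {#}}" by (simp only: eq)
  also have "\<dots> \<in> sets M"
  proof -
    have "Measurable.pred M (\<lambda>\<omega>. \<forall>q\<in>young_rows l. S \<omega> < clock \<epsilon> \<omega> q)"
    proof (intro pred_intros_finite finite_rows)
      fix q assume "q \<in> young_rows l"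
      then have [measurable]: "(\<lambda>\<omega>. clock \<epsilon> \<omega> q) \<in> borel_measurable M"
        using rows_subset[OF l] by (intro measurable_clock) auto
      show "Measurable.pred M (\<lambda>\<omega>. S \<omega> < clock \<epsilon> \<omega> q)" by measurable
    qed
    note [measurable] = this
    show ?thesis by measurable
  qed
  finally show "(\<lambda>\<omega>. random_partition \<epsilon> (S \<omega>) \<omega>) -` {l} \<inter> space M \<in> sets M" .
qed

text \<open>The jump times and the jump chain of the partition process started at time \<open>\<tau>\<close>.\<close>

abbreviation T :: "nat \<Rightarrow> 'a \<Rightarrow> real" where
  "T j \<omega> \<equiv> jump_time \<tau> (\<lambda>t. random_partition \<epsilon> t \<omega>) j"

abbreviation L :: "nat \<Rightarrow> 'a \<Rightarrow> nat multiset" where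
  "L j \<omega> \<equiv> jump_chain \<tau> (\<lambda>t. random_partition \<epsilon> t \<omega>) j"

lemma measurable_jump_chain_if:
  assumes "T j \<in> borel_measurable M"
  shows "L j \<in> measurable M (count_space partitions)"
  unfolding jump_chain_def using assms jump_time_pos[OF tau_pos]
  by (intro measurable_random_partition) auto

lemma measurable_jump_time: "T j \<in> borel_measurable M"
proof (induction j)
  case (Suc j)
  have "(\<lambda>\<omega>. (\<lambda>l \<omega>. if l = {#} then T j \<omega> else Min ((\<lambda>q. clock \<epsilon> \<omega> q) ` young_rows l)) (L j \<omega>) \<omega>)
      \<in> borel_measurable M"
  proof (rule measurable_compose_countable'[OF _ measurable_jump_chain_if[OF Suc] countable_partitions])
    fix l assume l: "l \<in> partitions"
    have "(\<lambda>\<omega>. Min ((\<lambda>q. clock \<epsilon> \<omega> q) ` young_rows l)) \<in> borel_measurable M"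
      using rows_subset[OF l] by (intro borel_measurable_Min finite_rows measurable_clock) auto
    with Suc show "(\<lambda>\<omega>. if l = {#} then T j \<omega> else Min ((\<lambda>q. clock \<epsilon> \<omega> q) ` young_rows l))
        \<in> borel_measurable M"
      by (cases "l = {#}") simp_all
  qed
  then show ?case by (simp only: jump_time_Suc[OF tau_pos])
qed simp

lemma measurable_jump_chain: "L j \<in> measurable M (count_space partitions)"
  by (intro measurable_jump_chain_if measurable_jump_time)

lemma sets_jump_chain_path:
  assumes "\<And>i. i \<le> m \<Longrightarrow> x i \<in> partitions"
  shows "{\<omega> \<in> space M. \<forall>i\<le>m. L i \<omega> = x i} \<in> sets M"
proof -
  have "{\<omega> \<in> space M. L i \<omega> = x i} \<in> sets M" if "i \<in> {..m}" for i
  proof -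
    have "L i -` {x i} \<inter> space M \<in> sets M"
      using assms that by (intro measurable_sets[OF measurable_jump_chain]) auto
    then show ?thesis by (simp add: vimage_def Int_def conj_commute)
  qed
  then have "{\<omega> \<in> space M. \<forall>i\<in>{..m}. L i \<omega> = x i} \<in> sets M"
    by (intro sets.sets_Collect_finite_All) auto
  then show ?thesis by (simp only: Ball_def atMost_iff)
qed

section \<open>The law of the jump chain\<close>

lemma L_0_eq_iff:
  assumes "regular \<epsilon> \<omega>" "l \<in> partitions"
  shows "L 0 \<omega> = l \<longleftrightarrow> (\<forall>q\<in>young_rows l. \<tau> < clock \<epsilon> \<omega> q) \<and>
    (\<forall>k. clock \<epsilon> \<omega> (Suc k, Suc (count l (Suc k))) \<le> \<tau>)"
  using assms(2) by (simp only: jump_chain_0 random_partition_eq_iff[OF assms(1) tau_pos]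
      has_multiplicities_iff all_ge_1_iff simp_thms)

lemma prodinf_LIMSEQ:
  "(\<lambda>K. \<Prod>k<K. 1 - exp (- real (Suc k) * \<tau>)) \<longlonglongrightarrow> (\<Prod>k. 1 - exp (- real (Suc k) * \<tau>))"
proof -
  have "norm (1 - exp (- real (Suc k) * \<tau>) - 1) = exp (- \<tau>) ^ Suc k" for k
    unfolding exp_of_nat_mult[symmetric] by (simp add: algebra_simps)
  moreover have "summable (\<lambda>k. exp (- \<tau>) ^ Suc k)"
    using tau_pos by (subst summable_Suc_iff) (simp add: summable_geometric)
  ultimately have "abs_convergent_prod (\<lambda>k. 1 - exp (- real (Suc k) * \<tau>))"
    by (intro summable_imp_abs_convergent_prod) simp
  then have "convergent_prod (\<lambda>k. 1 - exp (- real (Suc k) * \<tau>))"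
    by (rule abs_convergent_prod_imp_convergent_prod)
  then show ?thesis
    by (intro has_prod_imp_tendsto' convergent_prod_has_prod)
qed

text \<open>
  The law of the jump chain along a sequence of deletions. Starting in \<open>x 0\<close> concerns the
  clocks of the rows of \<open>x 0\<close>, which take part in the race, and for every length \<open>k\<close> one more
  clock, which has to ring by time \<open>\<tau>\<close>. The latter are infinitely many, hence the limit over
  the lengths up to \<open>K\<close>.
\<close>

lemma prob_path:
  assumes x0: "x 0 \<in> partitions"
    and steps: "\<And>i. i < m \<Longrightarrow> r i \<in> young_rows (x i) \<and> x (Suc i) = strike (x i) (r i)"
  shows "prob {\<omega> \<in> space M. \<forall>i\<le>m. L i \<omega> = x i} =
    exp (- \<tau> * real (sum_mset (x 0))) * (\<Prod>k. 1 - exp (- real (Suc k) * \<tau>)) *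
    (\<Prod>i<m. real (fst (r i)) / real (sum_mset (x i)))"
proof -
  define R where "R i = young_rows (x i)" for i
  \<comment> \<open>\<open>new k\<close> is the first row of length \<open>k + 1\<close> that is missing from \<open>x 0\<close>.\<close>
  define new where "new k = (Suc k, Suc (count (x 0) (Suc k)))" for k
  have new: "inj new" "new k \<notin> R 0" "new k \<in> {1..} \<times> {1..}" "fst (new k) = Suc k" for k
    by (auto simp: new_def inj_on_def R_def young_rows_def)
  have x_part: "x i \<in> partitions" if "i \<le> m" for i
    using that
  proof (induction i)
    case (Suc i)
    then show ?case using steps[of i] strike_partition by auto
  qed (simp add: x0)
  have chain: "r i \<in> R i \<and> R (Suc i) \<subseteq> R i - {r i}" if "i < m" for i
    using steps[OF that] rows_strike_subset by (auto simp: R_def)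
  have R_dec: "R i \<subseteq> R 0" if "i \<le> m" for i
    using that
  proof (induction i)
    case (Suc i)
    then show ?case using chain[of i] by auto
  qed simp
  have R0: "finite (R 0)" "R 0 \<subseteq> {1..} \<times> {1..}"
    using rows_subset[OF x0] by (auto simp: R_def finite_rows)
  define E where "E K = {\<omega> \<in> space M. (\<forall>q\<in>new ` {..<K}. clock \<epsilon> \<omega> q \<le> \<tau>) \<and>
      (\<forall>q\<in>R 0. \<tau> < clock \<epsilon> \<omega> q) \<and> (\<forall>i<m. \<forall>q\<in>R i - {r i}. clock \<epsilon> \<omega> (r i) < clock \<epsilon> \<omega> q)}" for K
  let ?c = "exp (- \<tau> * real (sum_mset (x 0))) * (\<Prod>i<m. real (fst (r i)) / real (sum_mset (x i)))"
  have prob_E: "prob (E K) = (\<Prod>k<K. 1 - exp (- real (Suc k) * \<tau>)) * ?c" for K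
  proof -
    have diff: "(new ` {..<K} \<union> R 0) - R 0 = new ` {..<K}" using new(2) by auto
    have "prob (E K) = (\<Prod>q\<in>new ` {..<K}. 1 - exp (- \<tau> * real (fst q))) *
        exp (- \<tau> * (\<Sum>q\<in>R 0. real (fst q))) * (\<Prod>i<m. real (fst (r i)) / (\<Sum>q\<in>R i. real (fst q)))"
      unfolding E_def
    proof (rule prob_race[of "new ` {..<K} \<union> R 0" R \<tau> m r, unfolded diff])
      show "new ` {..<K} \<union> R 0 \<subseteq> {1..} \<times> {1..}" using R0(2) new(3) by blast
      show "r i \<in> R i \<and> R (Suc i) \<subseteq> R i - {r i}" if "i < m" for i by (rule chain[OF that])
    qed (use R0 tau_pos in auto)
    also have "(\<Prod>q\<in>new ` {..<K}. 1 - exp (- \<tau> * real (fst q))) = (\<Prod>k<K. 1 - exp (- real (Suc k) * \<tau>))"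
      unfolding prod.reindex[OF inj_on_subset[OF new(1) subset_UNIV]]
      by (intro prod.cong refl) (simp add: new(4) algebra_simps)
    finally show ?thesis by (simp add: R_def sum_rows mult_ac)
  qed
  have E_sets: "E K \<in> sets M" for K
  proof -
    have "Measurable.pred M (\<lambda>\<omega>. \<forall>q\<in>new ` {..<K}. clock \<epsilon> \<omega> q \<le> \<tau>)"
    proof (intro pred_intros_finite)
      fix q assume "q \<in> new ` {..<K}"
      then have [measurable]: "(\<lambda>\<omega>. clock \<epsilon> \<omega> q) \<in> borel_measurable M"
        using new(3) by (intro measurable_clock) blast
      show "Measurable.pred M (\<lambda>\<omega>. clock \<epsilon> \<omega> q \<le> \<tau>)" by measurable
    qed simp
    moreover have "Measurable.pred M (\<lambda>\<omega>. \<forall>q\<in>R 0. \<tau> < clock \<epsilon> \<omega> q)"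
    proof (intro pred_intros_finite R0)
      fix q assume "q \<in> R 0"
      then have [measurable]: "(\<lambda>\<omega>. clock \<epsilon> \<omega> q) \<in> borel_measurable M"
        using R0 by (intro measurable_clock) auto
      show "Measurable.pred M (\<lambda>\<omega>. \<tau> < clock \<epsilon> \<omega> q)" by measurable
    qed
    moreover have "Measurable.pred M (\<lambda>\<omega>. \<forall>i\<in>{..<m}. \<forall>q\<in>R i - {r i}. clock \<epsilon> \<omega> (r i) < clock \<epsilon> \<omega> q)"
    proof (intro pred_intros_finite)
      fix i q assume "i \<in> {..<m}" "q \<in> R i - {r i}"
      then have "q \<in> R 0" "r i \<in> R 0" using R_dec[of i] chain[of i] by auto
      then have [measurable]: "(\<lambda>\<omega>. clock \<epsilon> \<omega> q) \<in> borel_measurable M"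
          "(\<lambda>\<omega>. clock \<epsilon> \<omega> (r i)) \<in> borel_measurable M"
        using R0 by (auto intro!: measurable_clock)
      show "Measurable.pred M (\<lambda>\<omega>. clock \<epsilon> \<omega> (r i) < clock \<epsilon> \<omega> q)" by measurable
    qed (auto simp: R_def finite_rows)
    ultimately have "Measurable.pred M (\<lambda>\<omega>. (\<forall>q\<in>new ` {..<K}. clock \<epsilon> \<omega> q \<le> \<tau>) \<and>
        (\<forall>q\<in>R 0. \<tau> < clock \<epsilon> \<omega> q) \<and>
        (\<forall>i\<in>{..<m}. \<forall>q\<in>R i - {r i}. clock \<epsilon> \<omega> (r i) < clock \<epsilon> \<omega> q))"
      by (intro pred_intros_logic)
    then show ?thesis by (simp only: E_def pred_def Ball_def lessThan_iff)
  qed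
  have "decseq E" by (auto simp: decseq_def E_def)
  with E_sets have "(\<lambda>K. prob (E K)) \<longlonglongrightarrow> prob (\<Inter>K. E K)"
    by (intro finite_Lim_measure_decseq) auto
  moreover have "(\<lambda>K. prob (E K)) \<longlonglongrightarrow> (\<Prod>k. 1 - exp (- real (Suc k) * \<tau>)) * ?c"
    unfolding prob_E by (intro tendsto_mult_right prodinf_LIMSEQ)
  ultimately have "prob (\<Inter>K. E K) = (\<Prod>k. 1 - exp (- real (Suc k) * \<tau>)) * ?c"
    by (rule LIMSEQ_unique)
  moreover have "prob {\<omega> \<in> space M. \<forall>i\<le>m. L i \<omega> = x i} = prob (\<Inter>K. E K)"
  proof (rule finite_measure_eq_AE)
    show "AE \<omega> in M. \<omega> \<in> {\<omega> \<in> space M. \<forall>i\<le>m. L i \<omega> = x i} \<longleftrightarrow> \<omega> \<in> (\<Inter>K. E K)"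
      using AE_regular AE_inj_on_clock AE_space
    proof eventually_elim
      case (elim \<omega>)
      have "(\<forall>i\<le>m. L i \<omega> = x i) \<longleftrightarrow> L 0 \<omega> = x 0 \<and>
          (\<forall>i<m. \<forall>q\<in>R i - {r i}. clock \<epsilon> \<omega> (r i) < clock \<epsilon> \<omega> q)"
        unfolding R_def by (rule jump_chain_path_iff[OF elim(1) tau_pos elim(2)], rule steps)
      also have "L 0 \<omega> = x 0 \<longleftrightarrow> (\<forall>q\<in>R 0. \<tau> < clock \<epsilon> \<omega> q) \<and> (\<forall>k. clock \<epsilon> \<omega> (new k) \<le> \<tau>)"
        unfolding L_0_eq_iff[OF elim(1) x0] R_def new_def ..
      also have "(\<forall>k. clock \<epsilon> \<omega> (new k) \<le> \<tau>) \<longleftrightarrow> (\<forall>K. \<forall>q\<in>new ` {..<K}. clock \<epsilon> \<omega> q \<le> \<tau>)"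
        by auto
      also have "((\<forall>q\<in>R 0. \<tau> < clock \<epsilon> \<omega> q) \<and> (\<forall>K. \<forall>q\<in>new ` {..<K}. clock \<epsilon> \<omega> q \<le> \<tau>)) \<and>
          (\<forall>i<m. \<forall>q\<in>R i - {r i}. clock \<epsilon> \<omega> (r i) < clock \<epsilon> \<omega> q) \<longleftrightarrow> (\<forall>K. \<omega> \<in> E K)"
        using elim(3) unfolding E_def mem_Collect_eq by meson
      finally show ?case using elim(3) by simp
    qed
    show "{\<omega> \<in> space M. \<forall>i\<le>m. L i \<omega> = x i} \<in> sets M"
      by (intro sets_jump_chain_path x_part)
    show "(\<Inter>K. E K) \<in> sets M" using E_sets by auto
  qed
  ultimately show ?thesis by (simp add: mult_ac)
qed

text \<open>Sequences of positive probability only make steps of the update rule.\<close>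

lemma possible_path:
  assumes pos: "prob {\<omega> \<in> space M. \<forall>i\<le>m. L i \<omega> = x i} > 0" and i: "i < m"
  shows "if x i = {#} then x (Suc i) = {#} else \<exists>q\<in>young_rows (x i). x (Suc i) = strike (x i) q"
proof -
  have "\<exists>\<omega>\<in>space M. regular \<epsilon> \<omega> \<and> inj_on (clock \<epsilon> \<omega>) ({1..} \<times> {1..}) \<and> (\<forall>i\<le>m. L i \<omega> = x i)"
  proof (rule ccontr)
    assume no: "\<not> ?thesis"
    have "AE \<omega> in M. \<not> (\<forall>i\<le>m. L i \<omega> = x i)"
      using AE_regular AE_inj_on_clock AE_space by eventually_elim (use no in blast)
    then have "emeasure M {\<omega> \<in> space M. \<forall>i\<le>m. L i \<omega> = x i} = 0"
      by (rule emeasure_eq_0_AE)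
    with pos show False by (simp add: measure_def)
  qed
  then obtain \<omega> where \<omega>: "regular \<epsilon> \<omega>" "inj_on (clock \<epsilon> \<omega>) ({1..} \<times> {1..})" "\<forall>i\<le>m. L i \<omega> = x i"
    by blast
  then have "x i = L i \<omega>" "x (Suc i) = L (Suc i) \<omega>" using i by auto
  then show ?thesis
    using jump_chain_Suc_empty[OF tau_pos, of \<epsilon> \<omega> i]
      jump_chain_Suc_strike[OF \<omega>(1) tau_pos \<omega>(2), of i] by auto
qed

lemma prob_step:
  assumes x: "\<And>i. i \<le> Suc j \<Longrightarrow> x i \<in> partitions"
    and pos: "prob {\<omega> \<in> space M. \<forall>i\<le>j. L i \<omega> = x i} > 0"
  shows "prob {\<omega> \<in> space M. \<forall>i\<le>Suc j. L i \<omega> = x i} =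
    prob {\<omega> \<in> space M. \<forall>i\<le>j. L i \<omega> = x i} * pmf (update_rule (x j)) (x (Suc j))"
proof (cases "x j = {#}")
  case True
  have stay: "L (Suc j) \<omega> = {#}" if "\<forall>i\<le>j. L i \<omega> = x i" for \<omega>
    using that True by (intro jump_chain_Suc_empty[OF tau_pos]) auto
  have "{\<omega> \<in> space M. \<forall>i\<le>Suc j. L i \<omega> = x i} =
      (if x (Suc j) = {#} then {\<omega> \<in> space M. \<forall>i\<le>j. L i \<omega> = x i} else {})"
  proof -
    have "(\<forall>i\<le>Suc j. L i \<omega> = x i) \<longleftrightarrow> (\<forall>i\<le>j. L i \<omega> = x i) \<and> L (Suc j) \<omega> = x (Suc j)" for \<omega>
      by (auto simp: le_Suc_eq)
    then show ?thesis by (auto simp: stay)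
  qed
  then show ?thesis using True by (simp add: update_rule_def)
next
  case False
  have ne: "x i \<noteq> {#}" if "i \<le> j" for i
  proof
    assume "x i = {#}"
    with that have "x j = {#}"
    proof (induction rule: dec_induct)
      case (step n)
      then show ?case using possible_path[OF pos, of n] by simp
    qed
    with False show False by simp
  qed
  have "\<exists>q\<in>young_rows (x i). x (Suc i) = strike (x i) q" if "i < j" for i
    using possible_path[OF pos that] ne[of i] that by simp
  then obtain r where r: "\<And>i. i < j \<Longrightarrow> r i \<in> young_rows (x i) \<and> x (Suc i) = strike (x i) (r i)"
    by metis
  show ?thesis
  proof (cases "\<exists>q\<in>young_rows (x j). x (Suc j) = strike (x j) q")
    case True
    then obtain q where q: "q \<in> young_rows (x j)" "x (Suc j) = strike (x j) q" by blast
    define r' where "r' = r(j := q)"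
    have "r' i \<in> young_rows (x i) \<and> x (Suc i) = strike (x i) (r' i)" if "i < Suc j" for i
      using that q r[of i] by (cases "i = j") (auto simp: r'_def)
    then have "prob {\<omega> \<in> space M. \<forall>i\<le>Suc j. L i \<omega> = x i} =
        exp (- \<tau> * real (sum_mset (x 0))) * (\<Prod>k. 1 - exp (- real (Suc k) * \<tau>)) *
        (\<Prod>i<Suc j. real (fst (r' i)) / real (sum_mset (x i)))"
      by (intro prob_path) (use x in auto)
    also have "(\<Prod>i<Suc j. real (fst (r' i)) / real (sum_mset (x i))) =
        (\<Prod>i<j. real (fst (r i)) / real (sum_mset (x i))) * pmf (update_rule (x j)) (x (Suc j))"
      using pmf_update_rule_strike[OF x[of j] q(1)] q(2) by (simp add: r'_def)
    finally show ?thesis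
      using prob_path[of x j r] x r by simp
  next
    case no: False
    have "\<not> prob {\<omega> \<in> space M. \<forall>i\<le>Suc j. L i \<omega> = x i} > 0"
      using possible_path[of "Suc j" x j] no False by auto
    then have "prob {\<omega> \<in> space M. \<forall>i\<le>Suc j. L i \<omega> = x i} = 0"
      by (simp add: not_less measure_le_0_iff)
    moreover have "pmf (update_rule (x j)) (x (Suc j)) = 0"
      using no x[of j] False unfolding strike_iff by (intro pmf_update_rule_eq_0) auto
    ultimately show ?thesis by simp
  qed
qed

lemma markov_chain_jump_chain:
  "markov_chain M partitions
      (\<lambda>l. exp (- \<tau> * real (sum_mset l)) * (\<Prod>j. 1 - exp (- real (Suc j) * \<tau>)))
      (\<lambda>l m. pmf (update_rule l) m) L"
  unfolding markov_chain_def
proof (intro conjI allI ballI impI)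
  show "L j \<in> measurable M (count_space partitions)" for j
    by (rule measurable_jump_chain)
  show "prob {\<omega> \<in> space M. L 0 \<omega> = l} =
      exp (- \<tau> * real (sum_mset l)) * (\<Prod>j. 1 - exp (- real (Suc j) * \<tau>))"
    if "l \<in> partitions" for l
    using prob_path[of "\<lambda>_. l" 0] that by simp
  show "\<P>(\<omega> in M. L (Suc j) \<omega> = x (Suc j) \<bar> \<forall>i\<le>j. L i \<omega> = x i) = pmf (update_rule (x j)) (x (Suc j))"
    if x: "\<forall>i\<le>Suc j. x i \<in> partitions" and pos: "prob {\<omega> \<in> space M. \<forall>i\<le>j. L i \<omega> = x i} > 0" for j x
  proof -
    have "{\<omega> \<in> space M. L (Suc j) \<omega> = x (Suc j) \<and> (\<forall>i\<le>j. L i \<omega> = x i)} =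
        {\<omega> \<in> space M. \<forall>i\<le>Suc j. L i \<omega> = x i}"
      by (auto simp: le_Suc_eq)
    with prob_step[of j x] x pos show ?thesis by (simp add: cond_prob_def)
  qed
qed

end

theorem proposition3p1:
  fixes M :: "'a measure" and \<epsilon> :: "nat \<Rightarrow> nat \<Rightarrow> 'a \<Rightarrow> real" and \<tau> :: real
  assumes "prob_space M"
    and "prob_space.indep_vars M (\<lambda>_. borel) (\<lambda>(k, j). \<epsilon> k j) ({1..} \<times> {1..})"
    and "\<And>k j. k \<ge> 1 \<Longrightarrow> j \<ge> 1 \<Longrightarrow> distributed M lborel (\<epsilon> k j) (exponential_density 1)"
    and "\<tau> > 0"
  defines "J \<equiv> \<lambda>\<omega>. num_jumps \<tau> (\<lambda>t. random_partition \<epsilon> t \<omega>)"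
    and "\<Lambda> \<equiv> \<lambda>j \<omega>. jump_chain \<tau> (\<lambda>t. random_partition \<epsilon> t \<omega>) j"
  shows "(AE \<omega> in M. J \<omega> < \<infinity> \<and> (\<forall>j. \<Lambda> j \<omega> = {#} \<longleftrightarrow> J \<omega> \<le> enat j)) \<and>
    markov_chain M partitions
      (\<lambda>l. exp (- \<tau> * real (sum_mset l)) * (\<Prod>j. 1 - exp (- real (Suc j) * \<tau>)))
      (\<lambda>l m. pmf (update_rule l) m) \<Lambda> \<and>
    (\<forall>n\<ge>1. \<forall>l\<in>partitions_of n. \<forall>m\<in>partitions.
      (\<forall>\<kappa> r. 1 \<le> r \<and> r \<le> count l \<kappa> \<and> m = l - replicate_mset r \<kappa> \<longrightarrow>
        pmf (update_rule l) m = real \<kappa> / real n) \<and>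
      ((\<nexists>\<kappa> r. 1 \<le> r \<and> r \<le> count l \<kappa> \<and> m = l - replicate_mset r \<kappa>) \<longrightarrow>
        pmf (update_rule l) m = 0))"
proof -
  interpret exponential_clocks M \<epsilon> \<tau>
    using assms(1-4) by (intro exponential_clocks.intro exponential_clocks_axioms.intro)
  have "AE \<omega> in M. J \<omega> < \<infinity> \<and> (\<forall>j. \<Lambda> j \<omega> = {#} \<longleftrightarrow> J \<omega> \<le> enat j)"
    unfolding J_def \<Lambda>_def
    by (intro AE_I2 conjI allI num_jumps_finite jump_chain_empty_iff tau_pos)
  then show ?thesis
    using markov_chain_jump_chain update_rule_transitions unfolding \<Lambda>_def by blast
qed

end
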